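(* Let $K\ge1$ and $m$ be positive integers, and for $k=1,\dots,K$ let $\sigma_k^2>0$, $P_k>0$, $\lambda_k\in[0,1)$; let $\mathcal N_0>0$. Set $\gamma=\frac{P_1+\cdots+P_K}{\mathcal N_0}$, $\theta_k=\frac{P_k}{P_1+\cdots+P_K}$ and $\Omega_k=\frac{P_k\sigma_k^2(1-\lambda_k^2)}{m\mathcal N_0}=\frac{\gamma\theta_k\sigma_k^2(1-\lambda_k^2)}{m}$. For $\boldsymbol\ell=(\ell_1,\dots,\ell_K)\in\mathbb N_0^K$ let $R_{\boldsymbol\ell,1},\dots,R_{\boldsymbol\ell,K}$ be independent with $R_{\boldsymbol\ell,k}\sim\mathcal G(m+\ell_k,\Omega_k)$ and let $F_{\mathcal A_{\boldsymbol\ell}}$ be the CDF of $\mathcal A_{\boldsymbol\ell}=\prod_{k=1}^K(1+R_{\boldsymbol\ell,k})$. Let $d_{\mathcal A_{\boldsymbol\ell}}=mK+\sum_{k=1}^K\ell_k$ and, for $x>0$, $$g_{\boldsymbol\ell}(x)=\int_{\{(t_1,\dots,t_K)\in[0,\infty)^K:\ \prod_{k=1}^K(1+t_k)\le x\}}\prod_{k=1}^K t_k^{m+\ell_k-1}\,dt_1\cdots dt_K.$$ Then for $x>0$ $$F_{\mathcal A_{\boldsymbol\ell}}(x)=\gamma^{-d_{\mathcal A_{\boldsymbol\ell}}}\prod_{k=1}^K\frac{1}{\Gamma(m+\ell_k)}\Big(\frac{m}{\theta_k\sigma_k^2(1-\lambda_k^2)}\Big)^{m+\ell_k}\sum_{n_1,\dots,n_K=0}^\infty\prod_{k=1}^K\frac{1}{n_k!}\Big(-\frac{m}{\gamma\theta_k\sigma_k^2(1-\lambda_k^2)}\Big)^{n_k}g_{\mathbf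 n+\boldsymbol\ell}(x),$$ where $\mathbf n=(n_1,\dots,n_K)$, and moreover $$g_{\boldsymbol\ell}(x)=\prod_{k=1}^K\Gamma(m+\ell_k)\;G_{K+1,K+1}^{0,K+1}\left(\left.\begin{array}{c}1,\,1+\ell_1+m,\dots,1+\ell_K+m\\1,\dots,1,0\end{array}\right|x\right).$$
   Context: $\mathcal G(a,b)$ denotes the Gamma distribution with shape $a$ and scale $b$ (density $x^{a-1}e^{-x/b}/(\Gamma(a)b^a)$, $x>0$). $G_{p,q}^{m,n}(\cdot|x)$ is the Meijer G-function. *)

theory Defs
  imports "HOL-Probability.Probability"
begin

definition gamma_density :: "real \<Rightarrow> real \<Rightarrow> real \<Rightarrow> real" where
  "gamma_density a b x =
     (if x > 0 then x powr (a - 1) * exp (- x / b) / (Gamma a * b powr a) else 0)"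

text \<open>Integrand of the Mellin--Barnes integral defining the Meijer G-function
  G^{mm,nn}_{p,q}(as; bs | x), p = length as, q = length bs, with x > 0 real.\<close>
definition meijerG_integrand ::
  "nat \<Rightarrow> nat \<Rightarrow> complex list \<Rightarrow> complex list \<Rightarrow> real \<Rightarrow> complex \<Rightarrow> complex" where
  "meijerG_integrand mm nn as bs x s =
     (\<Prod>j<mm. Gamma (bs ! j - s)) * (\<Prod>j<nn. Gamma (1 - as ! j + s))
   * (\<Prod>j\<in>{mm..<length bs}. rGamma (1 - bs ! j + s))
   * (\<Prod>j\<in>{nn..<length as}. rGamma (as ! j - s))
   * exp (s * of_real (ln x))"

text \<open>Admissible vertical line Re s = c: separates the poles of the Gamma(b_j - s), j < mm
  (to the right) from the poles of the Gamma(1 - a_j + s), j < nn (to the left).\<close>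
definition meijerG_admissible :: "nat \<Rightarrow> nat \<Rightarrow> complex list \<Rightarrow> complex list \<Rightarrow> real \<Rightarrow> bool" where
  "meijerG_admissible mm nn as bs c \<longleftrightarrow>
     (\<forall>j<nn. Re (as ! j) - 1 < c) \<and> (\<forall>j<mm. c < Re (bs ! j))"

text \<open>(1/(2 pi i)) times the integral over the line Re s = c (ds = i dt).\<close>
definition meijerG_line :: "real \<Rightarrow> nat \<Rightarrow> nat \<Rightarrow> complex list \<Rightarrow> complex list \<Rightarrow> real \<Rightarrow> complex" where
  "meijerG_line c mm nn as bs x =
     (LINT t|lborel. meijerG_integrand mm nn as bs x (Complex c t)) / (2 * pi)"

definition meijerG :: "nat \<Rightarrow> nat \<Rightarrow> complex list \<Rightarrow> complex list \<Rightarrow> real \<Rightarrow> complex" where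
  "meijerG mm nn as bs x = meijerG_line (SOME c. meijerG_admissible mm nn as bs c) mm nn as bs x"

definition g_fun :: "nat \<Rightarrow> nat \<Rightarrow> (nat \<Rightarrow> nat) \<Rightarrow> real \<Rightarrow> real" where
  "g_fun K m l x =
     (LINT t|PiM {1..K} (\<lambda>_. lborel).
        indicator {t. (\<forall>k\<in>{1..K}. 0 \<le> t k) \<and> (\<Prod>k\<in>{1..K}. 1 + t k) \<le> x} t
        * (\<Prod>k\<in>{1..K}. t k ^ (m + l k - 1)))"

end

theory Submission
  imports Defs "HOL-Complex_Analysis.Complex_Analysis"
begin

text \<open>The joint density of the independent Gamma variables is a product, and on the bounded region
  \<open>\<Prod>(1 + t\<^sub>k) \<le> x\<close> the factors \<open>exp (- t\<^sub>k / \<Omega>\<^sub>k)\<close> may be expanded into power series under the integral;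
  this gives the series for the distribution function.

  For the Meijer G-function, the Gamma quotients turn its integrand into
  \<open>x\<^sup>s / s \<cdot> \<Prod> \<Gamma>(s - a\<^sub>k) / \<Gamma>(s)\<close> with \<open>a\<^sub>k = m + l\<^sub>k\<close>. Multiplying the integrand by
  \<open>\<Gamma>(a) \<Gamma>(s - a) / \<Gamma>(s) = \<integral> t\<^bsup>a-1\<^esup> (1 + t)\<^bsup>-s\<^esup> dt\<close> corresponds by Fubini to the operation
  \<open>g(x) \<mapsto> \<integral> t\<^bsup>a-1\<^esup> g(x / (1 + t)) dt\<close>, which is also how the region integrals for \<open>K + 1\<close> and \<open>K\<close>
  variables are related. Everything thus reduces by induction to the Perron-type integral of
  \<open>x\<^sup>s / (s (s - 1))\<close>, which is evaluated by closing the contour with half circles.\<close>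

section \<open>The region integrals\<close>

text \<open>The induction over the variables cannot start with no variable: on a vertical line the
  remaining factor \<open>1 / s\<close> is not absolutely integrable, and Fubini would fail. It
  starts with one variable. For a = 1 the Gamma quotient gives \<open>1 / (s (s - 1))\<close>, which
  decays quadratically. A larger a is then reached without adding a variable: Gamma(s - a - 1) =
  Gamma(s - a) / (s - a - 1), and 1 / (s - a - 1) is the integral of
  \<open>(1 + t)^a (1 + t)^(-s)\<close> over t >= 0, so the same convolution applies with another
  weight. Each use of Fubini also returns absolute integrability of the new integrand, which is what
  the next use requires; this takes the place of growth estimates for Gamma. The abscissa c of the
  line stays arbitrary, because \<open>meijerG\<close> takes an unspecified admissible one.
  Admissibility amounts to c > 0 and c > m + l_k for all k, and the latter is exactly the condition
  for convergence of every Beta integral involved.\<close>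

interpretation lborel_product: product_sigma_finite "\<lambda>_. lborel :: real measure" ..

text \<open>An arbitrary index set replaces {1..K} so that an induction can split off one index at a
  time.\<close>

definition hyperbolic_region :: "'i set \<Rightarrow> real \<Rightarrow> ('i \<Rightarrow> real) set" where
  "hyperbolic_region I x = {t. (\<forall>k\<in>I. 0 \<le> t k) \<and> (\<Prod>k\<in>I. 1 + t k) \<le> x}"

lemma indicator_hyperbolic_region_measurable [measurable]:
  assumes "finite I"
  shows "(\<lambda>t. indicator (hyperbolic_region I x) t :: real) \<in> borel_measurable (PiM I (\<lambda>_. lborel))"
proof -
  \<comment> \<open>The region also contains functions that are not extensional, so only its trace
    on the space is a measurable set; on the space both indicators agree.\<close>
  have "{t \<in> space (PiM I (\<lambda>_. lborel)). (\<forall>k\<in>I. 0 \<le> t k) \<and> (\<Prod>k\<in>I. 1 + t k) \<le> x} \<in> sets (PiM I (\<lambda>_. lborel :: real measure))"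
    using assms by measurable
  then have "(\<lambda>t. indicator {t \<in> space (PiM I (\<lambda>_. lborel)). (\<forall>k\<in>I. 0 \<le> t k) \<and> (\<Prod>k\<in>I. 1 + t k) \<le> x} t :: real) \<in> borel_measurable (PiM I (\<lambda>_. lborel))"
    by (rule borel_measurable_indicator)
  then show ?thesis
    by (rule measurable_cong[THEN iffD1, rotated]) (auto simp: indicator_def hyperbolic_region_def)
qed

text \<open>The other factors of the product are at least 1, so the region lies in a box. The bound
  x is cruder than x - 1 but enough for integrability.\<close>

lemma hyperbolic_region_le:
  assumes "finite I" "t \<in> hyperbolic_region I x" "k \<in> I"
  shows "0 \<le> t k" "t k \<le> x"
proof -
  have t: "\<forall>k\<in>I. 0 \<le> t k" "(\<Prod>k\<in>I. 1 + t k) \<le> x" using assms by (auto simp: hyperbolic_region_def)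
  then show "0 \<le> t k" using assms by auto
  have "1 + t k = (\<Prod>j\<in>{k}. 1 + t j)" by simp
  also have "\<dots> \<le> (\<Prod>j\<in>I. 1 + t j)"
    using t assms by (intro prod_mono2) (auto simp: add_nonneg_nonneg)
  finally show "t k \<le> x" using t by simp
qed

text \<open>The region is not a product set, but the enclosing box is; on the box the integrand
  factorises into one-dimensional integrable functions, which serves as the dominating
  function.\<close>

lemma integrable_hyperbolic_region:
  fixes f :: "'i \<Rightarrow> real \<Rightarrow> real"
  assumes I: "finite I" and f: "\<And>k. k \<in> I \<Longrightarrow> continuous_on {0..x} (f k)"
    and [measurable]: "\<And>k. k \<in> I \<Longrightarrow> f k \<in> borel_measurable borel"
  shows "integrable (PiM I (\<lambda>_. lborel)) (\<lambda>t. indicator (hyperbolic_region I x) t * (\<Prod>k\<in>I. f k (t k)))"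
proof (rule Bochner_Integration.integrable_bound)
  show "integrable (PiM I (\<lambda>_. lborel)) (\<lambda>t. \<Prod>k\<in>I. indicator {0..x} (t k) * f k (t k))"
    using borel_integrable_atLeastAtMost'[OF f]
    by (intro lborel_product.product_integrable_prod I) (simp_all add: set_integrable_def)
  show "(\<lambda>t. indicator (hyperbolic_region I x) t * (\<Prod>k\<in>I. f k (t k))) \<in> borel_measurable (PiM I (\<lambda>_. lborel))"
    using I by measurable
  show "AE t in PiM I (\<lambda>_. lborel). norm (indicator (hyperbolic_region I x) t * (\<Prod>k\<in>I. f k (t k)))
      \<le> norm (\<Prod>k\<in>I. indicator {0..x} (t k) * f k (t k))"
  proof (intro AE_I2)
    fix t :: "'i \<Rightarrow> real"
    show "norm (indicator (hyperbolic_region I x) t * (\<Prod>k\<in>I. f k (t k))) \<le> norm (\<Prod>k\<in>I. indicator {0..x} (t k) * f k (t k))"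
    proof (cases "t \<in> hyperbolic_region I x")
      case True
      then have "(\<Prod>k\<in>I. indicator {0..x} (t k) * f k (t k)) = (\<Prod>k\<in>I. f k (t k))"
        using hyperbolic_region_le[OF I True] by (intro prod.cong) auto
      then show ?thesis using True by simp
    qed simp
  qed
qed

text \<open>The exponents are those of the integrand, so \<open>Suc (b k)\<close> plays the part of
  the Gamma shape m + l_k.\<close>

definition region_moment :: "'i set \<Rightarrow> ('i \<Rightarrow> nat) \<Rightarrow> real \<Rightarrow> real" where
  "region_moment I b x = (LINT t|PiM I (\<lambda>_. lborel). indicator (hyperbolic_region I x) t * (\<Prod>k\<in>I. t k ^ b k))"

lemma integrable_region_moment:
  "finite I \<Longrightarrow> integrable (PiM I (\<lambda>_. lborel)) (\<lambda>t. indicator (hyperbolic_region I x) t * (\<Prod>k\<in>I. t k ^ b k))"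
  by (rule integrable_hyperbolic_region) (auto intro!: continuous_intros)

lemma region_integrand_nonneg:
  fixes t :: "'i \<Rightarrow> real"
  assumes "finite I"
  shows "0 \<le> indicator (hyperbolic_region I x) t * (\<Prod>k\<in>I. t k ^ b k)"
  using hyperbolic_region_le(1)[OF assms, of t x]
  by (cases "t \<in> hyperbolic_region I x") (auto intro!: prod_nonneg zero_le_power)

lemma region_moment_nonneg: "finite I \<Longrightarrow> region_moment I b x \<ge> 0"
  unfolding region_moment_def by (intro Bochner_Integration.integral_nonneg region_integrand_nonneg)

text \<open>Besides being natural, this makes \<open>region_moment I b\<close> Borel measurable as a
  function of the bound, as the recursion over the variables requires.\<close>

lemma region_moment_mono:
  assumes I: "finite I" and "x \<le> y"
  shows "region_moment I b x \<le> region_moment I b y"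
  unfolding region_moment_def
proof (intro integral_mono integrable_region_moment I)
  fix t :: "'a \<Rightarrow> real"
  show "indicator (hyperbolic_region I x) t * (\<Prod>k\<in>I. t k ^ b k) \<le> indicator (hyperbolic_region I y) t * (\<Prod>k\<in>I. t k ^ b k)"
  proof (cases "t \<in> hyperbolic_region I x")
    case True
    then have "t \<in> hyperbolic_region I y" using assms by (auto simp: hyperbolic_region_def)
    then show ?thesis using True by simp
  qed (use region_integrand_nonneg[OF I, of y t b] in simp)
qed

text \<open>Once the coordinate \<open>i\<close> is fixed to y >= 0, the other coordinates range
  over the region with bound x / (1 + y). The integrand is nonnegative, so the splitting is done by
  Tonelli on the extended nonnegative integral and then carried back to the Lebesgue
  integral.\<close>

lemma region_moment_insert:
  assumes I: "finite I" "i \<notin> I"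
  shows "region_moment (insert i I) b x = (LINT y|lborel. indicator {0..} y * (y ^ b i * region_moment I b (x / (1 + y))))"
proof -
  let ?f = "\<lambda>t. indicator (hyperbolic_region (insert i I) x) t * (\<Prod>k\<in>insert i I. t k ^ b k) :: real"
  let ?g = "\<lambda>x t. indicator (hyperbolic_region I x) t * (\<Prod>k\<in>I. t k ^ b k) :: real"
  have fm: "?f \<in> borel_measurable (PiM (insert i I) (\<lambda>_. lborel))"
    using integrable_region_moment[of "insert i I" x b] I by auto
  have upd: "?f (t(i := y)) = (indicator {0..} y * y ^ b i) * ?g (x / (1 + y)) t" for t y
  proof -
    have p: "(\<Prod>k\<in>I. h k ((t(i := y)) k)) = (\<Prod>k\<in>I. h k (t k))" for h :: "'a \<Rightarrow> real \<Rightarrow> real"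
      using I by (intro prod.cong) auto
    have "t(i := y) \<in> hyperbolic_region (insert i I) x \<longleftrightarrow> 0 \<le> y \<and> t \<in> hyperbolic_region I (x / (1 + y))"
    proof (cases "0 \<le> y")
      case True
      have "(\<Prod>k\<in>insert i I. 1 + (t(i := y)) k) = (1 + y) * (\<Prod>k\<in>I. 1 + t k)"
        using I p[of "\<lambda>_ z. 1 + z"] by simp
      moreover have "(\<forall>k\<in>insert i I. 0 \<le> (t(i := y)) k) \<longleftrightarrow> (\<forall>k\<in>I. 0 \<le> t k)"
        using True I by auto
      ultimately show ?thesis using True
        by (simp add: hyperbolic_region_def pos_le_divide_eq mult.commute)
    qed (auto simp: hyperbolic_region_def)
    moreover have "(\<Prod>k\<in>insert i I. (t(i := y)) k ^ b k) = y ^ b i * (\<Prod>k\<in>I. t k ^ b k)"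
      using I p[of "\<lambda>k z. z ^ b k"] by simp
    ultimately show ?thesis by (simp add: indicator_def)
  qed
  have mono: "mono (region_moment I b)" using region_moment_mono[OF I(1)] by (auto simp: mono_def)
  have [measurable]: "region_moment I b \<in> borel_measurable borel" by (rule borel_measurable_mono[OF mono])
  have "region_moment (insert i I) b x = enn2real (\<integral>\<^sup>+t. ennreal (?f t) \<partial>PiM (insert i I) (\<lambda>_. lborel))"
    unfolding region_moment_def using fm I by (intro integral_eq_nn_integral AE_I2 region_integrand_nonneg) auto
  also have "(\<integral>\<^sup>+t. ennreal (?f t) \<partial>PiM (insert i I) (\<lambda>_. lborel))
      = (\<integral>\<^sup>+y. (\<integral>\<^sup>+t. ennreal (?f (t(i := y))) \<partial>PiM I (\<lambda>_. lborel)) \<partial>lborel)"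
    using I fm by (subst lborel_product.product_nn_integral_insert_rev) auto
  also have "\<dots> = (\<integral>\<^sup>+y. ennreal (indicator {0..} y * (y ^ b i * region_moment I b (x / (1 + y)))) \<partial>lborel)"
  proof (intro nn_integral_cong)
    fix y :: real
    have "(\<integral>\<^sup>+t. ennreal (?f (t(i := y))) \<partial>PiM I (\<lambda>_. lborel)) = ennreal (LINT t|PiM I (\<lambda>_. lborel). (indicator {0..} y * y ^ b i) * ?g (x / (1 + y)) t)"
      unfolding upd using I
      by (intro nn_integral_eq_integral integrable_mult_right integrable_region_moment AE_I2
            mult_nonneg_nonneg[OF _ region_integrand_nonneg]) (auto simp: indicator_def)
    also have "(LINT t|PiM I (\<lambda>_. lborel). (indicator {0..} y * y ^ b i) * ?g (x / (1 + y)) t) = indicator {0..} y * (y ^ b i * region_moment I b (x / (1 + y)))"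
      unfolding region_moment_def by (subst integral_mult_right_zero) (simp only: mult.assoc)
    finally show "(\<integral>\<^sup>+t. ennreal (?f (t(i := y))) \<partial>PiM I (\<lambda>_. lborel)) = ennreal (indicator {0..} y * (y ^ b i * region_moment I b (x / (1 + y))))" .
  qed
  also have "enn2real \<dots> = (LINT y|lborel. indicator {0..} y * (y ^ b i * region_moment I b (x / (1 + y))))"
    using region_moment_nonneg[OF I(1)]
    by (intro integral_eq_nn_integral[symmetric] AE_I2) (auto simp: indicator_def)
  finally show ?thesis .
qed

section \<open>The distribution function\<close>

text \<open>A product measure is determined by its values on boxes, and over a box the integral of
  the product density factorises. Sigma-finiteness is asked at every index, also outside
  \<open>I\<close>, because the product locale quantifies over all indices.\<close>

lemma (in product_sigma_finite) PiM_density: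
  fixes f :: "'i \<Rightarrow> 'a \<Rightarrow> ennreal"
  assumes I: "finite I" and [measurable]: "\<And>i. i \<in> I \<Longrightarrow> f i \<in> borel_measurable (M i)"
    and sf: "\<And>i. sigma_finite_measure (density (M i) (f i))"
  shows "PiM I (\<lambda>i. density (M i) (f i)) = density (PiM I M) (\<lambda>t. \<Prod>i\<in>I. f i (t i))"
proof -
  interpret D: product_sigma_finite "\<lambda>i. density (M i) (f i)" using sf by (simp add: product_sigma_finite_def)
  show ?thesis
  proof (rule D.PiM_eqI[symmetric, OF I])
    show "sets (density (PiM I M) (\<lambda>t. \<Prod>i\<in>I. f i (t i))) = sets (PiM I (\<lambda>i. density (M i) (f i)))"
      by (simp cong: sets_PiM_cong)
    fix A assume A: "\<And>i. i \<in> I \<Longrightarrow> A i \<in> sets (density (M i) (f i))"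
    then have A' [measurable]: "\<And>i. i \<in> I \<Longrightarrow> A i \<in> sets (M i)" by simp
    have "emeasure (density (PiM I M) (\<lambda>t. \<Prod>i\<in>I. f i (t i))) (Pi\<^sub>E I A)
        = (\<integral>\<^sup>+t. (\<Prod>i\<in>I. f i (t i)) * indicator (Pi\<^sub>E I A) t \<partial>PiM I M)"
      using I A' by (intro emeasure_density sets_PiM_I_finite) auto
    also have "\<dots> = (\<integral>\<^sup>+t. (\<Prod>i\<in>I. f i (t i) * indicator (A i) (t i)) \<partial>PiM I M)"
    proof (intro nn_integral_cong)
      fix t assume t: "t \<in> space (PiM I M)"
      show "(\<Prod>i\<in>I. f i (t i)) * indicator (Pi\<^sub>E I A) t = (\<Prod>i\<in>I. f i (t i) * indicator (A i) (t i))"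
      proof (cases "t \<in> Pi\<^sub>E I A")
        case True
        then show ?thesis by (auto intro!: prod.cong simp: PiE_iff)
      next
        case False
        then obtain i where "i \<in> I" "t i \<notin> A i" using t by (auto simp: PiE_iff space_PiM)
        then have "(\<Prod>i\<in>I. f i (t i) * indicator (A i) (t i)) = 0" using I by (intro prod_zero bexI[of _ i]) auto
        then show ?thesis using False by simp
      qed
    qed
    also have "\<dots> = (\<Prod>i\<in>I. \<integral>\<^sup>+y. f i y * indicator (A i) y \<partial>M i)"
      using I by (intro product_nn_integral_prod) auto
    also have "\<dots> = (\<Prod>i\<in>I. emeasure (density (M i) (f i)) (A i))"
      by (intro prod.cong refl) (simp add: emeasure_density)
    finally show "emeasure (density (PiM I M) (\<lambda>t. \<Prod>i\<in>I. f i (t i))) (Pi\<^sub>E I A) = (\<Prod>i\<in>I. emeasure (density (M i) (f i)) (A i))" .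
  qed
qed

text \<open>Differs from \<open>gamma_density\<close> only at 0 when \<open>a = 1\<close>.\<close>
definition erlang_weight :: "nat \<Rightarrow> real \<Rightarrow> real \<Rightarrow> real" where
  "erlang_weight a b y = indicator {0..} y * (y ^ (a - 1) * exp (- y / b) / (Gamma (real a) * b ^ a))"

lemma erlang_weight_eq_gamma_density:
  assumes "a \<ge> 1" "b > 0" "y \<noteq> 0"
  shows "erlang_weight a b y = gamma_density (real a) b y"
  using assms
  by (auto simp: erlang_weight_def gamma_density_def indicator_def powr_realpow[symmetric] of_nat_diff)

lemma erlang_weight_measurable [measurable]: "erlang_weight a b \<in> borel_measurable borel"
  unfolding erlang_weight_def by measurable

lemma erlang_weight_nonneg: "a \<ge> 1 \<Longrightarrow> b > 0 \<Longrightarrow> erlang_weight a b y \<ge> 0"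
  by (auto simp: erlang_weight_def indicator_def intro!: divide_nonneg_nonneg mult_nonneg_nonneg Gamma_real_nonneg)

lemma (in prob_space) prob_prod_gamma_le:
  fixes R :: "'i \<Rightarrow> 'a \<Rightarrow> real"
  assumes I: "finite I" "I \<noteq> {}"
    and a: "\<And>k. k \<in> I \<Longrightarrow> a k \<ge> 1" and b: "\<And>k. k \<in> I \<Longrightarrow> b k > 0"
    and indep: "indep_vars (\<lambda>_. borel) R I"
    and distr: "\<And>k. k \<in> I \<Longrightarrow> distributed M lborel (R k) (\<lambda>y. ennreal (gamma_density (real (a k)) (b k) y))"
  shows "measure M {\<omega> \<in> space M. (\<Prod>k\<in>I. 1 + R k \<omega>) \<le> x}
    = (\<Prod>k\<in>I. 1 / (Gamma (real (a k)) * b k ^ a k)) *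
      (LINT t|PiM I (\<lambda>_. lborel). indicator (hyperbolic_region I x) t * (\<Prod>k\<in>I. t k ^ (a k - 1) * exp (- t k / b k)))"
proof -
  have rv: "random_variable borel (R k)" if "k \<in> I" for k
    using distributed_measurable[OF distr[OF that]] by simp
  \<comment> \<open>Outside \<open>I\<close> any sigma-finite choice will do for
    \<open>PiM_density\<close>; the uniform law on the unit interval is one.\<close>
  define w where "w = (\<lambda>k. if k \<in> I then (\<lambda>y. ennreal (erlang_weight (a k) (b k) y)) else indicator {0..1})"
  have [measurable]: "w k \<in> borel_measurable borel" for k by (auto simp: w_def)
  have D: "distr M borel (R k) = density lborel (w k)" if "k \<in> I" for k
  proof -
    have "distr M borel (R k) = distr M lborel (R k)" by (intro distr_cong) auto
    also have "\<dots> = density lborel (\<lambda>y. ennreal (gamma_density (real (a k)) (b k) y))"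
      using distributed_distr_eq_density[OF distr[OF that]] .
    also have "\<dots> = density lborel (w k)"
    proof (rule density_cong)
      show "(\<lambda>y. ennreal (gamma_density (real (a k)) (b k) y)) \<in> borel_measurable lborel"
        using distributed_borel_measurable[OF distr[OF that]] .
      \<comment> \<open>The two densities can disagree only at the null set {0}.\<close>
      show "AE y in lborel. ennreal (gamma_density (real (a k)) (b k) y) = w k y"
        using AE_lborel_singleton[of 0] by eventually_elim (use that a b in \<open>simp add: w_def erlang_weight_eq_gamma_density\<close>)
    qed auto
    finally show ?thesis .
  qed
  have sf: "sigma_finite_measure (density lborel (w k))" for k
  proof (cases "k \<in> I")
    case True
    then interpret P: prob_space "density lborel (w k)"
      unfolding D[OF True, symmetric] by (intro prob_space_distr rv)
    show ?thesis by unfold_locales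
  next
    case False
    have "finite_measure (density lborel (w k))"
      using False by (intro finite_measureI) (simp add: w_def emeasure_density)
    then show ?thesis by (simp add: finite_measure_def)
  qed
  have joint: "distr M (PiM I (\<lambda>_. borel)) (\<lambda>\<omega>. \<lambda>k\<in>I. R k \<omega>) = density (PiM I (\<lambda>_. lborel)) (\<lambda>t. \<Prod>k\<in>I. w k (t k))"
  proof -
    have "distr M (PiM I (\<lambda>_. borel)) (\<lambda>\<omega>. \<lambda>k\<in>I. R k \<omega>) = PiM I (\<lambda>k. distr M borel (R k))"
      using indep_vars_iff_distr_eq_PiM'[OF I(2) rv] indep by simp
    also have "\<dots> = PiM I (\<lambda>k. density lborel (w k))" by (intro PiM_cong D) auto
    also have "\<dots> = density (PiM I (\<lambda>_. lborel)) (\<lambda>t. \<Prod>k\<in>I. w k (t k))"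
      using I sf by (intro lborel_product.PiM_density) auto
    finally show ?thesis .
  qed
  \<comment> \<open>The event carries no sign condition, unlike the hyperbolic region. The
    difference is absorbed by the weights, which vanish at negative arguments.\<close>
  let ?S = "{t \<in> space (PiM I (\<lambda>_. borel)). (\<Prod>k\<in>I. 1 + t k) \<le> x} :: ('i \<Rightarrow> real) set"
  let ?W = "\<lambda>t. \<Prod>k\<in>I. erlang_weight (a k) (b k) (t k)"
  have S: "?S \<in> sets (PiM I (\<lambda>_. borel))" using I by measurable
  have S': "?S \<in> sets (PiM I (\<lambda>_. lborel))" using S by (simp cong: sets_PiM_cong)
  have W: "?W \<in> borel_measurable (PiM I (\<lambda>_. lborel))" using I by measurable
  have eq: "?W t * indicator ?S t = (\<Prod>k\<in>I. 1 / (Gamma (real (a k)) * b k ^ a k)) *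
      (indicator (hyperbolic_region I x) t * (\<Prod>k\<in>I. t k ^ (a k - 1) * exp (- t k / b k)))"
    if t: "t \<in> space (PiM I (\<lambda>_. lborel))" for t
  proof (cases "\<forall>k\<in>I. 0 \<le> t k")
    case True
    have "?W t = (\<Prod>k\<in>I. (1 / (Gamma (real (a k)) * b k ^ a k)) * (t k ^ (a k - 1) * exp (- t k / b k)))"
      using True by (intro prod.cong) (auto simp: erlang_weight_def)
    also have "\<dots> = (\<Prod>k\<in>I. 1 / (Gamma (real (a k)) * b k ^ a k)) * (\<Prod>k\<in>I. t k ^ (a k - 1) * exp (- t k / b k))"
      by (rule prod.distrib)
    finally have W: "?W t = \<dots>" .
    have "indicator ?S t = (indicator (hyperbolic_region I x) t :: real)"
      using True t by (auto simp: indicator_def hyperbolic_region_def space_PiM)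
    then show ?thesis unfolding W by (simp only: mult_ac)
  next
    case False
    then obtain k where "k \<in> I" "t k < 0" by auto
    then have "?W t = 0" using I by (intro prod_zero bexI[of _ k]) (auto simp: erlang_weight_def)
    then show ?thesis using False by (auto simp: hyperbolic_region_def)
  qed
  have "measure M {\<omega> \<in> space M. (\<Prod>k\<in>I. 1 + R k \<omega>) \<le> x} = measure (distr M (PiM I (\<lambda>_. borel)) (\<lambda>\<omega>. \<lambda>k\<in>I. R k \<omega>)) ?S"
    using S rv by (subst measure_distr) (auto intro!: measurable_restrict arg_cong[where f="measure M"] simp: space_PiM)
  also have "\<dots> = enn2real (\<integral>\<^sup>+t. ennreal (?W t * indicator ?S t) \<partial>PiM I (\<lambda>_. lborel))"
  proof -
    have "(\<Prod>k\<in>I. w k (t k)) * indicator ?S t = ennreal (?W t * indicator ?S t)" for t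
      using a b by (auto simp: w_def prod_ennreal erlang_weight_nonneg indicator_def intro!: prod.cong)
    then show ?thesis
      unfolding joint measure_def using S' I by (subst emeasure_density) auto
  qed
  also have "\<dots> = (LINT t|PiM I (\<lambda>_. lborel). ?W t * indicator ?S t)"
    using W S' a b by (intro integral_eq_nn_integral[symmetric])
      (auto intro!: borel_measurable_times borel_measurable_indicator mult_nonneg_nonneg prod_nonneg erlang_weight_nonneg)
  also have "\<dots> = (LINT t|PiM I (\<lambda>_. lborel). (\<Prod>k\<in>I. 1 / (Gamma (real (a k)) * b k ^ a k)) *
      (indicator (hyperbolic_region I x) t * (\<Prod>k\<in>I. t k ^ (a k - 1) * exp (- t k / b k))))"
    by (intro Bochner_Integration.integral_cong refl eq)
  finally show ?thesis by simp
qed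

section \<open>Power series expansion of the exponential factors under the integral\<close>

text \<open>The boxes are cofinal among the finite sets of multi-indices. An unordered sum that
  exists can therefore be computed along boxes, where a sum of products factorises.\<close>

lemma filterlim_PiE_atMost:
  assumes "finite I"
  shows "filterlim (\<lambda>N. PiE I (\<lambda>_. {..N})) (finite_subsets_at_top (PiE I (\<lambda>_. UNIV :: nat set))) sequentially"
  unfolding filterlim_iff eventually_finite_subsets_at_top
proof (intro allI impI, elim exE conjE)
  fix P :: "('a \<Rightarrow> nat) set \<Rightarrow> bool" and X
  assume X: "finite X" "X \<subseteq> PiE I (\<lambda>_. UNIV)" and P: "\<forall>Y. finite Y \<and> X \<subseteq> Y \<and> Y \<subseteq> PiE I (\<lambda>_. UNIV) \<longrightarrow> P Y"
  \<comment> \<open>The largest entry of any multi-index in \<open>X\<close>.\<close>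
  let ?N = "Max ((\<lambda>(n, k). n k) ` (X \<times> I))"
  show "\<forall>\<^sub>F N in sequentially. P (PiE I (\<lambda>_. {..N}))"
    using eventually_ge_at_top[of ?N]
  proof eventually_elim
    case (elim N)
    have le: "n k \<le> N" if "n \<in> X" "k \<in> I" for n k
    proof -
      have "n k \<le> ?N" using X assms that by (intro Max_ge) (auto intro!: image_eqI[of _ _ "(n, k)"])
      then show ?thesis using elim by simp
    qed
    have sub: "X \<subseteq> PiE I (\<lambda>_. {..N})"
    proof
      fix n assume n: "n \<in> X"
      then have "n \<in> PiE I (\<lambda>_. UNIV)" using X(2) by (rule subsetD[rotated])
      then have "n k = undefined" if "k \<notin> I" for k using that by (rule PiE_arb)
      then show "n \<in> PiE I (\<lambda>_. {..N})" using le[OF n] by (intro PiE_I) simp_all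
    qed
    have "finite (PiE I (\<lambda>_. {..N}))" using finite_PiE[OF assms, of "\<lambda>_. {..N}"] by simp
    moreover have "PiE I (\<lambda>_. {..N}) \<subseteq> PiE I (\<lambda>_. UNIV)" by (rule PiE_mono) simp
    ultimately show ?case using P[THEN spec, THEN mp] sub by simp
  qed
qed

lemma sum_power_over_fact_le_exp:
  fixes y :: real assumes "y \<ge> 0" shows "(\<Sum>n\<le>N. y ^ n / fact n) \<le> exp y"
proof -
  have "(\<lambda>n. y ^ n / fact n) sums exp y" using exp_converges[of y] by (simp add: divide_inverse mult.commute scaleR_conv_of_real)
  then show ?thesis
    using assms sum_le_suminf[of "\<lambda>n. y ^ n / fact n" "{..N}"] by (auto simp: sums_iff)
qed

text \<open>A partial sum over a box is the integral of a product of truncated exponential series.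
  With |q| in place of -q these integrals stay below that of the full exponentials, which is finite
  on the bounded region; this yields absolute summability. Dominated convergence with the same bound
  then identifies the sum for -q.\<close>

lemma has_sum_region_exp_expansion:
  fixes q :: "'i \<Rightarrow> real" and b :: "'i \<Rightarrow> nat"
  assumes I: "finite I"
  shows "((\<lambda>n. (\<Prod>k\<in>I. (- q k) ^ n k / fact (n k)) * region_moment I (\<lambda>k. n k + b k) x) has_sum
    (LINT t|PiM I (\<lambda>_. lborel). indicator (hyperbolic_region I x) t * (\<Prod>k\<in>I. t k ^ b k * exp (- (q k * t k)))))
    (PiE I (\<lambda>_. UNIV))"
proof -
  let ?M = "PiM I (\<lambda>_. lborel :: real measure)"
  let ?T = "PiE I (\<lambda>_. UNIV :: nat set)"
  \<comment> \<open>The coefficients \<open>q\<close> are an explicit argument of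
    \<open>coef\<close>, \<open>e\<close> and \<open>p\<close>, since these are used both at -q and
    at |q|.\<close>
  define coef where "coef = (\<lambda>q n. (\<Prod>k\<in>I. (q k) ^ n k / fact (n k)) * region_moment I (\<lambda>k. n k + b k) x)"
  define e where "e = (\<lambda>q t. indicator (hyperbolic_region I x) t * (\<Prod>k\<in>I. t k ^ b k * exp (q k * t k)))"
  define p where "p = (\<lambda>N q t. indicator (hyperbolic_region I x) t * (\<Prod>k\<in>I. t k ^ b k * (\<Sum>n\<le>N. (q k * t k) ^ n / fact n)))"
  have int_e: "integrable ?M (e q)" for q
    unfolding e_def by (rule integrable_hyperbolic_region[OF I]) (auto intro!: continuous_intros)
  have int_p: "integrable ?M (p N q)" for N q
    unfolding p_def by (rule integrable_hyperbolic_region[OF I]) (auto intro!: continuous_intros)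
  have pe: "p N q t \<le> e q t" if "\<And>k. k \<in> I \<Longrightarrow> q k \<ge> 0" for N q t
    unfolding p_def e_def
  proof (cases "t \<in> hyperbolic_region I x")
    case True
    then have "0 \<le> t k" if "k \<in> I" for k using hyperbolic_region_le[OF I] that by auto
    then show "indicator (hyperbolic_region I x) t * (\<Prod>k\<in>I. t k ^ b k * (\<Sum>n\<le>N. (q k * t k) ^ n / fact n))
        \<le> indicator (hyperbolic_region I x) t * (\<Prod>k\<in>I. t k ^ b k * exp (q k * t k))"
      using that by (intro mult_left_mono prod_mono) (auto intro!: mult_nonneg_nonneg sum_nonneg sum_power_over_fact_le_exp mult_left_mono)
  qed simp
  \<comment> \<open>Expanding a product of finite sums turns the truncated exponentials into a sum
    over multi-indices, each term being a multiple of a region integrand.\<close>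
  have sum_box: "(\<Sum>n\<in>PiE I (\<lambda>_. {..N}). coef q n) = (LINT t|?M. p N q t)" for N q
  proof -
    have pN: "p N q = (\<lambda>t. \<Sum>n\<in>PiE I (\<lambda>_. {..N}). (\<Prod>k\<in>I. q k ^ n k / fact (n k)) * (indicator (hyperbolic_region I x) t * (\<Prod>k\<in>I. t k ^ (n k + b k))))"
    proof
      fix t
      have "p N q t = indicator (hyperbolic_region I x) t * (\<Prod>k\<in>I. \<Sum>n\<le>N. t k ^ b k * ((q k * t k) ^ n / fact n))"
        unfolding p_def by (simp add: sum_distrib_left)
      also have "\<dots> = indicator (hyperbolic_region I x) t * (\<Sum>n\<in>PiE I (\<lambda>_. {..N}). \<Prod>k\<in>I. t k ^ b k * ((q k * t k) ^ n k / fact (n k)))"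
        using I by (subst prod_sum_PiE) auto
      also have "\<dots> = (\<Sum>n\<in>PiE I (\<lambda>_. {..N}). (\<Prod>k\<in>I. q k ^ n k / fact (n k)) * (indicator (hyperbolic_region I x) t * (\<Prod>k\<in>I. t k ^ (n k + b k))))"
        unfolding sum_distrib_left
        by (intro sum.cong refl)
           (simp add: power_mult_distrib power_add prod.distrib prod_dividef mult_ac)
      finally show "p N q t = (\<Sum>n\<in>PiE I (\<lambda>_. {..N}). (\<Prod>k\<in>I. q k ^ n k / fact (n k)) * (indicator (hyperbolic_region I x) t * (\<Prod>k\<in>I. t k ^ (n k + b k))))" .
    qed
    have "(LINT t|?M. p N q t) = (\<Sum>n\<in>PiE I (\<lambda>_. {..N}). (\<Prod>k\<in>I. q k ^ n k / fact (n k)) * region_moment I (\<lambda>k. n k + b k) x)"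
      using I unfolding region_moment_def pN
      by (subst Bochner_Integration.integral_sum) (auto intro!: integrable_mult_right integrable_region_moment)
    then show ?thesis by (simp add: coef_def)
  qed
  have abs: "\<bar>coef q n\<bar> = coef (\<lambda>k. \<bar>q k\<bar>) n" for q n
    using region_moment_nonneg[OF I] by (simp add: coef_def abs_mult abs_prod power_abs)
  have lim: "filterlim (\<lambda>N. PiE I (\<lambda>_. {..N})) (finite_subsets_at_top ?T) sequentially"
    using I by (rule filterlim_PiE_atMost)
  have "(\<lambda>n. norm (coef (\<lambda>k. - q k) n)) summable_on ?T"
  proof (rule nonneg_bdd_above_summable_on)
    show "bdd_above (sum (\<lambda>n. norm (coef (\<lambda>k. - q k) n)) ` {F. F \<subseteq> ?T \<and> finite F})"
    proof (rule bdd_aboveI2)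
      fix F assume F: "F \<in> {F. F \<subseteq> ?T \<and> finite F}"
      have "\<forall>\<^sub>F Y in finite_subsets_at_top ?T. F \<subseteq> Y"
        using F by (auto simp: eventually_finite_subsets_at_top)
      then have "\<forall>\<^sub>F N in sequentially. F \<subseteq> PiE I (\<lambda>_. {..N})"
        by (rule eventually_compose_filterlim[OF _ lim])
      then obtain N where N: "F \<subseteq> PiE I (\<lambda>_. {..N})" by (auto simp: eventually_sequentially)
      have "(\<Sum>n\<in>F. norm (coef (\<lambda>k. - q k) n)) \<le> (\<Sum>n\<in>PiE I (\<lambda>_. {..N}). norm (coef (\<lambda>k. - q k) n))"
        using I N by (intro sum_mono2 finite_PiE) auto
      also have "\<dots> = (LINT t|?M. p N (\<lambda>k. \<bar>q k\<bar>) t)" by (simp add: abs sum_box)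
      also have "\<dots> \<le> (LINT t|?M. e (\<lambda>k. \<bar>q k\<bar>) t)"
        by (intro integral_mono int_p int_e pe) auto
      finally show "(\<Sum>n\<in>F. norm (coef (\<lambda>k. - q k) n)) \<le> (LINT t|?M. e (\<lambda>k. \<bar>q k\<bar>) t)" .
    qed
  qed auto
  then have "coef (\<lambda>k. - q k) summable_on ?T" by (rule abs_summable_summable)
  then obtain S where S: "(coef (\<lambda>k. - q k) has_sum S) ?T" by (auto simp: summable_on_def)
  then have "(\<lambda>N. \<Sum>n\<in>PiE I (\<lambda>_. {..N}). coef (\<lambda>k. - q k) n) \<longlonglongrightarrow> S"
    unfolding has_sum_def by (rule filterlim_compose[OF _ lim])
  then have lim1: "(\<lambda>N. LINT t|?M. p N (\<lambda>k. - q k) t) \<longlonglongrightarrow> S" by (simp add: sum_box)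
  have lim2: "(\<lambda>N. LINT t|?M. p N (\<lambda>k. - q k) t) \<longlonglongrightarrow> (LINT t|?M. e (\<lambda>k. - q k) t)"
  proof (rule integral_dominated_convergence)
    show "integrable ?M (e (\<lambda>k. \<bar>q k\<bar>))" by (rule int_e)
    show "AE t in ?M. (\<lambda>N. p N (\<lambda>k. - q k) t) \<longlonglongrightarrow> e (\<lambda>k. - q k) t"
    proof (intro AE_I2)
      fix t
      have "(\<lambda>N. \<Sum>n\<le>N. y ^ n / fact n) \<longlonglongrightarrow> exp y" for y :: real
        using exp_converges[of y] by (simp add: sums_def_le divide_inverse mult.commute scaleR_conv_of_real)
      then show "(\<lambda>N. p N (\<lambda>k. - q k) t) \<longlonglongrightarrow> e (\<lambda>k. - q k) t"
        unfolding p_def e_def by (intro tendsto_intros)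
    qed
    fix N
    show "AE t in ?M. norm (p N (\<lambda>k. - q k) t) \<le> e (\<lambda>k. \<bar>q k\<bar>) t"
    proof (intro AE_I2)
      fix t
      have "norm (p N (\<lambda>k. - q k) t) \<le> p N (\<lambda>k. \<bar>q k\<bar>) t"
      proof (cases "t \<in> hyperbolic_region I x")
        case True
        then have t: "0 \<le> t k" if "k \<in> I" for k using hyperbolic_region_le[OF I] that by auto
        have "\<bar>\<Prod>k\<in>I. t k ^ b k * (\<Sum>n\<le>N. (- q k * t k) ^ n / fact n)\<bar>
            \<le> (\<Prod>k\<in>I. t k ^ b k * (\<Sum>n\<le>N. (\<bar>q k\<bar> * t k) ^ n / fact n))"
          unfolding abs_prod
        proof (intro prod_mono conjI)
          fix k assume k: "k \<in> I"
          have "\<bar>\<Sum>n\<le>N. (- q k * t k) ^ n / fact n\<bar> \<le> (\<Sum>n\<le>N. \<bar>(- q k * t k) ^ n / fact n\<bar>)"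
            by (rule sum_abs)
          also have "\<dots> = (\<Sum>n\<le>N. (\<bar>q k\<bar> * t k) ^ n / fact n)"
            using t[OF k] by (simp add: abs_mult power_abs)
          finally show "\<bar>t k ^ b k * (\<Sum>n\<le>N. (- q k * t k) ^ n / fact n)\<bar> \<le> t k ^ b k * (\<Sum>n\<le>N. (\<bar>q k\<bar> * t k) ^ n / fact n)"
            using t[OF k] unfolding abs_mult by (simp add: mult_left_mono)
        qed simp
        then show ?thesis using True by (simp add: p_def)
      qed (simp add: p_def)
      also have "\<dots> \<le> e (\<lambda>k. \<bar>q k\<bar>) t" by (rule pe) simp
      finally show "norm (p N (\<lambda>k. - q k) t) \<le> e (\<lambda>k. \<bar>q k\<bar>) t" .
    qed
  qed (use int_e int_p in auto)
  have "S = (LINT t|?M. e (\<lambda>k. - q k) t)" by (rule LIMSEQ_unique[OF lim1 lim2])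
  with S show ?thesis by (simp add: coef_def e_def)
qed

lemma (in prob_space) gamma_product_cdf_has_sum:
  fixes R :: "'i \<Rightarrow> 'a \<Rightarrow> real"
  assumes I: "finite I" "I \<noteq> {}"
    and a: "\<And>k. k \<in> I \<Longrightarrow> a k \<ge> 1" and b: "\<And>k. k \<in> I \<Longrightarrow> b k > 0"
    and indep: "indep_vars (\<lambda>_. borel) R I"
    and distr: "\<And>k. k \<in> I \<Longrightarrow> distributed M lborel (R k) (\<lambda>y. ennreal (gamma_density (real (a k)) (b k) y))"
  shows "((\<lambda>n. (\<Prod>k\<in>I. 1 / (Gamma (real (a k)) * b k ^ a k)) *
      ((\<Prod>k\<in>I. (- (1 / b k)) ^ n k / fact (n k)) * region_moment I (\<lambda>k. n k + (a k - 1)) x))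
    has_sum measure M {\<omega> \<in> space M. (\<Prod>k\<in>I. 1 + R k \<omega>) \<le> x}) {n. \<forall>k. k \<notin> I \<longrightarrow> n k = 0}"
proof -
  let ?C = "\<Prod>k\<in>I. 1 / (Gamma (real (a k)) * b k ^ a k)"
  have "((\<lambda>n. ?C * ((\<Prod>k\<in>I. (- (1 / b k)) ^ n k / fact (n k)) * region_moment I (\<lambda>k. n k + (a k - 1)) x)) has_sum
    (?C * (LINT t|PiM I (\<lambda>_. lborel). indicator (hyperbolic_region I x) t * (\<Prod>k\<in>I. t k ^ (a k - 1) * exp (- (1 / b k * t k))))))
    (PiE I (\<lambda>_. UNIV))"
    by (intro has_sum_cmult_right has_sum_region_exp_expansion I)
  also have "?C * (LINT t|PiM I (\<lambda>_. lborel). indicator (hyperbolic_region I x) t * (\<Prod>k\<in>I. t k ^ (a k - 1) * exp (- (1 / b k * t k))))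
      = measure M {\<omega> \<in> space M. (\<Prod>k\<in>I. 1 + R k \<omega>) \<le> x}"
    using prob_prod_gamma_le[OF I a b indep distr, of x] by simp
  finally have sum: "((\<lambda>n. ?C * ((\<Prod>k\<in>I. (- (1 / b k)) ^ n k / fact (n k)) * region_moment I (\<lambda>k. n k + (a k - 1)) x)) has_sum
      measure M {\<omega> \<in> space M. (\<Prod>k\<in>I. 1 + R k \<omega>) \<le> x}) (PiE I (\<lambda>_. UNIV))" .
  \<comment> \<open>Only exponents at indices in \<open>I\<close> enter, so restricting a
    multi-index to \<open>I\<close> changes nothing.\<close>
  have cong: "region_moment I (\<lambda>k. restrict n I k + (a k - 1)) x = region_moment I (\<lambda>k. n k + (a k - 1)) x" for n
    unfolding region_moment_def by (intro Bochner_Integration.integral_cong arg_cong2[where f="(*)"] prod.cong refl) simp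
  let ?i = "\<lambda>n k. if k \<in> I then n k else 0 :: nat"
  let ?f = "\<lambda>n. ?C * ((\<Prod>k\<in>I. (- (1 / b k)) ^ n k / fact (n k)) * region_moment I (\<lambda>k. n k + (a k - 1)) x)"
  let ?p = "measure M {\<omega> \<in> space M. (\<Prod>k\<in>I. 1 + R k \<omega>) \<le> x}"
  \<comment> \<open>Two encodings of multi-indices on \<open>I\<close>: \<open>undefined\<close>
    outside \<open>I\<close> for the extensional functions, 0 outside \<open>I\<close> for the
    target index set.\<close>
  have "(?f has_sum ?p) {n. \<forall>k. k \<notin> I \<longrightarrow> n k = 0} \<longleftrightarrow> (?f has_sum ?p) (PiE I (\<lambda>_. UNIV))"
  proof (rule has_sum_reindex_bij_witness[where i = ?i and j = "\<lambda>n. restrict n I"])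
    fix n :: "'i \<Rightarrow> nat"
    show "?i (restrict n I) = n" if "n \<in> {n. \<forall>k. k \<notin> I \<longrightarrow> n k = 0}"
      using that by (intro ext) simp
    show "restrict (?i n) I = n" if "n \<in> PiE I (\<lambda>_. UNIV)"
    proof -
      have "restrict (?i n) I = restrict n I" by (intro ext) (simp add: restrict_def)
      then show ?thesis using PiE_restrict[OF that] by (simp only: )
    qed
    show "?f (restrict n I) = ?f n"
    proof -
      have "(\<Prod>k\<in>I. (- (1 / b k)) ^ restrict n I k / fact (restrict n I k)) = (\<Prod>k\<in>I. (- (1 / b k)) ^ n k / fact (n k))"
        by (intro prod.cong) simp_all
      then show ?thesis by (simp only: cong)
    qed
  qed simp_all
  with sum show ?thesis by (simp only: )
qed

section \<open>Mellin--Barnes integrals\<close>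

lemma lborel_integrable_one_plus_powr:
  assumes "c > (1::real)"
  shows "integrable lborel (\<lambda>t. indicator {0..} t * (1 + t) powr (-c))"
proof -
  have "((\<lambda>y. - ((1 + y) powr (1 - c)) / (c - 1)) \<longlongrightarrow> 0) at_top"
    using assms by real_asymp
  moreover have "((\<lambda>y. - ((1 + y) powr (1 - c)) / (c - 1)) has_real_derivative (1 + t) powr (-c)) (at t)"
    if "t \<ge> 0" for t
  proof -
    have "((\<lambda>z. z powr (1 - c)) has_real_derivative (1 - c) * (1 + t) powr (1 - c - 1)) (at (1 + t))"
      by (rule has_real_derivative_powr) (use that in simp)
    moreover have "((\<lambda>y. 1 + y) has_real_derivative 1) (at t)"
      by (auto intro!: derivative_eq_intros)
    ultimately have "((\<lambda>y. (1 + y) powr (1 - c)) has_real_derivative (1 - c) * (1 + t) powr (1 - c - 1) * 1) (at t)"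
      by (rule DERIV_chain2)
    note deriv = DERIV_cmult[OF this, of "- (1 / (c - 1))"]
    have "- (1 / (c - 1)) * ((1 - c) * A * 1) = A" for A
      using assms by (simp add: field_simps)
    then show ?thesis using deriv by (simp only: ) simp
  qed
  ultimately have "(\<integral>\<^sup>+t. ennreal ((1 + t) powr (-c)) * indicator {0..} t \<partial>lborel)
      = ennreal (0 - (- ((1 + 0) powr (1 - c)) / (c - 1)))"
    by (intro nn_integral_FTC_atLeast) auto
  then show ?thesis
    by (intro integrableI_nonneg) (auto simp: mult.commute indicator_mult_ennreal less_top)
qed

text \<open>Complex powers of the positive base 1 + t are written with the real logarithm; this is
  the law (1 + t)^(1 - s) = (1 + t) (1 + t)^(-s) in that form.\<close>

lemma exp_scaled_ln_one_plus:
  assumes "t > - 1"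
  shows "exp ((1 - s) * complex_of_real (ln (1 + t))) = of_real (1 + t) * exp (- s * of_real (ln (1 + t)))"
proof -
  have "exp ((1 - s) * complex_of_real (ln (1 + t))) = exp (of_real (ln (1 + t))) * exp (- s * of_real (ln (1 + t)))"
    by (simp add: exp_add[symmetric] algebra_simps)
  also have "exp (complex_of_real (ln (1 + t))) = of_real (1 + t)"
    using assms by (simp only: exp_of_real) simp
  finally show ?thesis .
qed

text \<open>Since t^b <= (1 + t)^b, the kernel is bounded by a real power of 1 + t with exponent
  below -1.\<close>

lemma integrable_shifted_power_kernel:
  assumes "real b + 1 < Re s"
  shows "integrable lborel (\<lambda>t. indicator {0..} t * (of_real (t ^ b) * exp (- s * of_real (ln (1 + t)))) :: complex)"
proof (rule Bochner_Integration.integrable_bound)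
  show "integrable lborel (\<lambda>t. indicator {0..} t * (1 + t) powr (-(Re s - real b)))"
    using assms by (intro lborel_integrable_one_plus_powr) auto
  show "AE t in lborel. norm (indicator {0..} t * (of_real (t ^ b) * exp (- s * of_real (ln (1 + t)))) :: complex)
      \<le> norm (indicator {0..} t * (1 + t) powr (-(Re s - real b)))"
  proof (intro AE_I2)
    fix t :: real
    have "t ^ b * exp (- Re s * ln (1 + t)) \<le> (1 + t) powr (-(Re s - real b))" if "t \<ge> 0"
    proof -
      have "t ^ b \<le> (1 + t) ^ b" using that by (intro power_mono) auto
      also have "\<dots> = exp (real b * ln (1 + t))" using that by (simp add: exp_of_nat_mult)
      finally have "t ^ b * exp (- Re s * ln (1 + t)) \<le> exp (real b * ln (1 + t)) * exp (- Re s * ln (1 + t))"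
        by (intro mult_right_mono) auto
      then show ?thesis using that by (simp add: powr_def exp_add[symmetric] algebra_simps)
    qed
    then show "norm (indicator {0..} t * (of_real (t ^ b) * exp (- s * of_real (ln (1 + t)))) :: complex)
      \<le> norm (indicator {0..} t * (1 + t) powr (-(Re s - real b)))"
      by (auto simp: indicator_def norm_mult norm_power)
  qed
qed measurable

text \<open>The antiderivative \<open>?F\<close> equals -1 / (s - 1) at 0 and tends to 0 at infinity
  because 1 - Re s < 0.\<close>

lemma integral_one_plus_powr_complex:
  assumes s: "1 < Re s"
  shows "(LINT t|lborel. indicator {0..} t * exp (- s * of_real (ln (1 + t)))) = 1 / (s - 1)"
proof -
  let ?F = "\<lambda>t::real. - exp ((1 - s) * of_real (ln (1 + t))) / (s - 1)"
  have s1: "s \<noteq> 1" using s by auto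
  \<comment> \<open>The fundamental theorem is applied on the open half-line; the endpoint 0 is
    restored at the end as a null set.\<close>
  have int: "set_integrable lborel {0<..} (\<lambda>t. exp (- s * of_real (ln (1 + t))))"
  proof -
    have "integrable lborel (\<lambda>t. indicator {0<..} t *\<^sub>R (indicator {0..} t * (of_real (t ^ 0) * exp (- s * of_real (ln (1 + t)))) :: complex))"
      using s by (intro integrable_mult_indicator integrable_shifted_power_kernel) auto
    then show ?thesis
      unfolding set_integrable_def
      by (rule Bochner_Integration.integrable_cong[OF refl, THEN iffD1, rotated]) (auto simp: indicator_def)
  qed
  have "(LBINT t=ereal 0..\<infinity>. exp (- s * of_real (ln (1 + t)))) = 0 - (- 1 / (s - 1))"
  proof (rule interval_integral_FTC_integrable)
    fix t :: real assume "ereal 0 < ereal t"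
    then have t: "t > 0" by simp
    have "((\<lambda>t::real. (1 - s) * of_real (ln (1 + t))) has_vector_derivative (1 - s) * of_real (1 / (1 + t))) (at t)"
      using t by (intro has_vector_derivative_mult_right has_vector_derivative_of_real)
        (auto intro!: derivative_eq_intros simp flip: has_real_derivative_iff_has_vector_derivative)
    then have "((exp \<circ> (\<lambda>t::real. (1 - s) * of_real (ln (1 + t)))) has_vector_derivative
        ((1 - s) * of_real (1 / (1 + t))) * exp ((1 - s) * of_real (ln (1 + t)))) (at t)"
      by (rule field_vector_diff_chain_at) (rule DERIV_exp)
    then have "((\<lambda>t. (- 1 / (s - 1)) * exp ((1 - s) * of_real (ln (1 + t)))) has_vector_derivative
        (- 1 / (s - 1)) * (((1 - s) * of_real (1 / (1 + t))) * exp ((1 - s) * of_real (ln (1 + t))))) (at t)"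
      unfolding o_def by (rule has_vector_derivative_mult_right)
    moreover have "(- 1 / (s - 1)) * (((1 - s) * of_real (1 / (1 + t))) * exp ((1 - s) * of_real (ln (1 + t))))
        = exp (- s * of_real (ln (1 + t)))"
    proof -
      have "exp ((1 - s) * of_real (ln (1 + t))) = of_real (1 + t) * exp (- s * of_real (ln (1 + t)))"
        using t by (intro exp_scaled_ln_one_plus) auto
      moreover have "complex_of_real (1 + t) \<noteq> 0" using t by (metis add_pos_pos less_irrefl of_real_eq_0_iff zero_less_one)
      moreover have "1 - s = - (s - 1)" "s - 1 \<noteq> 0" using s1 by auto
      ultimately show ?thesis
        by (simp only: divide_inverse of_real_mult of_real_inverse of_real_1 mult_minus_left mult_minus_right minus_minus mult_1_left mult.assoc)
           (simp add: mult.assoc[symmetric] del: of_real_add)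
    qed
    ultimately show "(?F has_vector_derivative exp (- s * of_real (ln (1 + t)))) (at t)"
      by (simp add: field_simps)
    show "isCont (\<lambda>t. exp (- s * complex_of_real (ln (1 + t)))) t"
      using t by (intro continuous_intros) auto
  next
    show "set_integrable lborel (einterval (ereal 0) \<infinity>) (\<lambda>t. exp (- s * of_real (ln (1 + t))))"
      using int by (simp add: einterval_def greaterThan_def)
    show "((?F \<circ> real_of_ereal) \<longlongrightarrow> - 1 / (s - 1)) (at_right (ereal 0))"
    proof -
      have "isCont ?F 0" using s1 by (intro continuous_intros) auto
      then have "(?F \<longlongrightarrow> - 1 / (s - 1)) (at_right 0)"
        by (intro filterlim_at_split[THEN iffD1, THEN conjunct2]) (simp add: isCont_def)
      then show ?thesis by (simp add: ereal_tendsto_simps1)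
    qed
    show "((?F \<circ> real_of_ereal) \<longlongrightarrow> 0) (at_left \<infinity>)"
    proof -
      have "((\<lambda>t. exp ((1 - Re s) * ln (1 + t)) / norm (s - 1)) \<longlongrightarrow> 0) at_top"
        using s s1 by real_asymp
      then have "(?F \<longlongrightarrow> 0) at_top"
        by (rule tendsto_0_le[where K=1]) (auto simp: norm_divide)
      then show ?thesis by (simp add: ereal_tendsto_simps1)
    qed
  qed auto
  also have "(LBINT t=ereal 0..\<infinity>. exp (- s * of_real (ln (1 + t))))
      = (LINT t|lborel. indicator {0<..} t *\<^sub>R exp (- s * of_real (ln (1 + t))))"
    by (simp add: interval_lebesgue_integral_def set_lebesgue_integral_def einterval_def greaterThan_def)
  also have "\<dots> = (LINT t|lborel. indicator {0..} t * exp (- s * of_real (ln (1 + t))))"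
    by (rule integral_cong_AE) (use AE_lborel_singleton[of 0] in \<open>auto simp: indicator_def\<close>)
  finally show ?thesis by simp
qed

text \<open>Multiplying the kernel by \<open>1 + t\<close> lowers \<open>s\<close> by one, so that
  \<open>I (a + 1) s = I a (s - 1) - I a s\<close>.\<close>
lemma integral_shifted_power_kernel:
  assumes "real (Suc b) < Re s"
  shows "(LINT t|lborel. indicator {0..} t * (of_real (t ^ b) * exp (- s * of_real (ln (1 + t)))))
    = Gamma (of_nat (Suc b)) * Gamma (s - of_nat (Suc b)) / Gamma s"
  using assms
proof (induction b arbitrary: s)
  case 0
  have "s - 1 \<notin> \<int>\<^sub>\<le>\<^sub>0" using 0 by (auto elim!: nonpos_Ints_cases simp: complex_eq_iff)
  then have "Gamma (s - 1) \<noteq> 0" "Gamma (s - 1 + 1) = (s - 1) * Gamma (s - 1)"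
    by (simp_all only: Gamma_eq_zero_iff Gamma_plus1 not_False_eq_True)
  then show ?case using integral_one_plus_powr_complex[of s] 0 by simp
next
  case (Suc b)
  let ?I = "\<lambda>b s t. indicator {0..} t * (of_real (t ^ b) * exp (- s * of_real (ln (1 + t)))) :: complex"
  have split: "?I (Suc b) s t = ?I b (s - 1) t - ?I b s t" for t
  proof (cases "t \<ge> 0")
    case True
    have "exp (- (s - 1) * of_real (ln (1 + t))) = of_real (1 + t) * exp (- s * of_real (ln (1 + t)))"
      using exp_scaled_ln_one_plus[of t s] True by simp
    then show ?thesis by (simp only: ) (simp add: algebra_simps)
  qed simp
  have "(LINT t|lborel. ?I (Suc b) s t) = (LINT t|lborel. ?I b (s - 1) t) - (LINT t|lborel. ?I b s t)"
    unfolding split using Suc.prems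
    by (intro Bochner_Integration.integral_diff integrable_shifted_power_kernel) auto
  also have "\<dots> = Gamma (of_nat (Suc b)) * Gamma (s - 1 - of_nat (Suc b)) / Gamma (s - 1)
      - Gamma (of_nat (Suc b)) * Gamma (s - of_nat (Suc b)) / Gamma s"
    using Suc.prems by (simp only: Suc.IH minus_complex.sel one_complex.sel of_nat_Suc)
  also have "\<dots> = Gamma (of_nat (Suc (Suc b))) * Gamma (s - of_nat (Suc (Suc b))) / Gamma s"
  proof -
    \<comment> \<open>z is the smallest Gamma argument that occurs, and Re z > 0. After reduction to
      Gamma(z) and Gamma(s - 1), the claim is (s - 1) - z = b + 1.\<close>
    define z where "z = s - of_nat (Suc (Suc b))"
    have nz: "z \<notin> \<int>\<^sub>\<le>\<^sub>0" "s - 1 \<notin> \<int>\<^sub>\<le>\<^sub>0" using Suc.prems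
      by (auto elim!: nonpos_Ints_cases simp: complex_eq_iff z_def)
    have g1: "Gamma (s - of_nat (Suc b)) = z * Gamma z"
      using Gamma_plus1[OF nz(1)] by (simp add: z_def algebra_simps)
    have g2: "Gamma s = (s - 1) * Gamma (s - 1)" using Gamma_plus1[OF nz(2)] by simp
    have "of_nat (Suc b) \<notin> (\<int>\<^sub>\<le>\<^sub>0 :: complex set)"
      by (metis of_nat_in_nonpos_Ints_iff nat.distinct(1))
    from Gamma_plus1[OF this]
    have g3: "Gamma (of_nat (Suc (Suc b)) :: complex) = of_nat (Suc b) * Gamma (of_nat (Suc b))"
      by (simp add: add.commute)
    have e: "s - 1 - of_nat (Suc b) = z" by (simp add: z_def)
    have s: "s - 1 = z + of_nat (Suc b)" by (simp add: z_def)
    have "Gamma (s - 1) \<noteq> 0" "s - 1 \<noteq> 0" using nz by (auto simp: Gamma_eq_zero_iff)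
    then show ?thesis
      unfolding g1 g2 g3 e z_def[symmetric] by (simp add: divide_simps) (simp add: s algebra_simps)
  qed
  finally show ?case .
qed

section \<open>Convolution along a vertical line\<close>

text \<open>Interchanging the two integrals gathers the t-dependence into \<open>k\<close>. The
  weight \<open>w\<close> is left general because both t^b and (1 + t)^n are used later. That
  \<open>k\<close> inherits measurability, and that H k is integrable, are consequences of
  Fubini.\<close>

lemma complex_mellin_convolution:
  fixes H :: "real \<Rightarrow> complex" and w :: "real \<Rightarrow> real"
  assumes H: "integrable lborel H"
    and wm [measurable]: "w \<in> borel_measurable borel"
    and w: "integrable lborel (\<lambda>t. indicator {0..} t * (w t * (1 + t) powr (-c)))"
    and x: "x > 0"
    and k: "\<And>\<tau>. (LINT t|lborel. indicator {0..} t * (of_real (w t) * exp (- Complex c \<tau> * of_real (ln (1 + t))))) = k \<tau>"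
  shows "integrable lborel (\<lambda>\<tau>. H \<tau> * k \<tau>)"
    and "(LINT t|lborel. indicator {0..} t * (of_real (w t) * (LINT \<tau>|lborel. H \<tau> * exp (Complex c \<tau> * of_real (ln (x / (1 + t)))))))
       = (LINT \<tau>|lborel. H \<tau> * k \<tau> * exp (Complex c \<tau> * of_real (ln x)))"
proof -
  have [measurable]: "H \<in> borel_measurable borel" using H by auto
  have Cm [measurable]: "(\<lambda>\<tau>. Complex c \<tau>) \<in> borel_measurable borel"
    unfolding Complex_eq by measurable
  let ?f = "\<lambda>t \<tau>. indicator {0..} t * (of_real (w t) * (H \<tau> * exp (Complex c \<tau> * (of_real (ln x) - of_real (ln (1 + t))))))"
  \<comment> \<open>The modulus of a power on the line depends on c only, so the double integrand
    separates in absolute value.\<close>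
  have nrm: "norm (?f t \<tau>) = (indicator {0..} t * (\<bar>w t\<bar> * (1 + t) powr (-c))) * (norm (H \<tau>) * x powr c)" for t \<tau>
    using x by (auto simp: norm_mult powr_def indicator_def exp_add[symmetric] algebra_simps simp flip: of_real_diff)
  have wa: "integrable lborel (\<lambda>t. indicator {0..} t * (\<bar>w t\<bar> * (1 + t) powr (-c)))"
    using integrable_abs[OF w] by (simp add: abs_mult)
  have int: "integrable (lborel \<Otimes>\<^sub>M lborel) (case_prod ?f)"
  proof (rule lborel_pair.Fubini_integrable)
    show "case_prod ?f \<in> borel_measurable (lborel \<Otimes>\<^sub>M lborel)" by measurable
    show "integrable lborel (\<lambda>t. LINT \<tau>|lborel. norm (case_prod ?f (t, \<tau>)))"
      using wa H unfolding prod.case nrm by simp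
    show "AE t in lborel. integrable lborel (\<lambda>\<tau>. case_prod ?f (t, \<tau>))"
    proof (intro AE_I2)
      fix t :: real
      have "integrable lborel (\<lambda>\<tau>. norm (?f t \<tau>))" unfolding nrm using H by simp
      moreover have "(\<lambda>\<tau>. ?f t \<tau>) \<in> borel_measurable lborel" by measurable
      ultimately show "integrable lborel (\<lambda>\<tau>. case_prod ?f (t, \<tau>))"
        unfolding prod.case by (rule integrable_norm_cancel)
    qed
  qed
  have inner: "(LINT t|lborel. ?f t \<tau>) = H \<tau> * k \<tau> * exp (Complex c \<tau> * of_real (ln x))" for \<tau>
  proof -
    have "(LINT t|lborel. ?f t \<tau>) = (LINT t|lborel. (H \<tau> * exp (Complex c \<tau> * of_real (ln x))) * (indicator {0..} t * (of_real (w t) * exp (- Complex c \<tau> * of_real (ln (1 + t))))))"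
      by (intro Bochner_Integration.integral_cong) (auto simp: algebra_simps exp_diff exp_minus divide_simps)
    then show ?thesis by (simp only: integral_mult_right_zero k) (simp add: algebra_simps)
  qed
  have "integrable lborel (\<lambda>\<tau>. LINT t|lborel. ?f t \<tau>)"
    using lborel_pair.integrable_snd[OF int] .
  then have *: "integrable lborel (\<lambda>\<tau>. H \<tau> * k \<tau> * exp (Complex c \<tau> * of_real (ln x)))"
    unfolding inner .
  then have [measurable]: "(\<lambda>\<tau>. H \<tau> * k \<tau> * exp (Complex c \<tau> * of_real (ln x))) \<in> borel_measurable borel"
    by auto
  \<comment> \<open>Fubini gives integrability of H k times x^s. A unimodular factor turns x^s into
    the positive constant x^c, which is then divided out.\<close>
  have untwist: "exp (Complex c \<tau> * of_real L) * exp (- \<i> * of_real (\<tau> * L)) = of_real (exp (c * L))" for \<tau> L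
  proof -
    have "Complex c \<tau> * of_real L + - \<i> * of_real (\<tau> * L) = of_real (c * L)"
      by (simp add: complex_eq_iff)
    then show ?thesis by (simp only: exp_add[symmetric] exp_of_real)
  qed
  have "integrable lborel (\<lambda>\<tau>. (H \<tau> * k \<tau> * exp (Complex c \<tau> * of_real (ln x))) * exp (- \<i> * of_real (\<tau> * ln x)))"
  proof (rule Bochner_Integration.integrable_bound[OF *])
    show "(\<lambda>\<tau>. (H \<tau> * k \<tau> * exp (Complex c \<tau> * of_real (ln x))) * exp (- \<i> * of_real (\<tau> * ln x))) \<in> borel_measurable lborel"
      by measurable
  qed (simp add: norm_mult)
  then have "integrable lborel (\<lambda>\<tau>. (H \<tau> * k \<tau>) * of_real (exp (c * ln x)))"
    by (simp only: mult.assoc untwist)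
  then have "integrable lborel (\<lambda>\<tau>. (H \<tau> * k \<tau>) * of_real (exp (c * ln x)) * of_real (exp (- (c * ln x))))"
    by (rule integrable_mult_left)
  then have "integrable lborel (\<lambda>\<tau>. (H \<tau> * k \<tau>) * (of_real (exp (c * ln x)) * of_real (exp (- (c * ln x)))))"
    by (simp only: mult.assoc)
  then show "integrable lborel (\<lambda>\<tau>. H \<tau> * k \<tau>)"
    by (simp only: of_real_mult[symmetric] exp_add[symmetric]) simp
  have "(LINT t|lborel. indicator {0..} t * (of_real (w t) * (LINT \<tau>|lborel. H \<tau> * exp (Complex c \<tau> * of_real (ln (x / (1 + t)))))))
      = (LINT t|lborel. LINT \<tau>|lborel. ?f t \<tau>)"
  proof (intro Bochner_Integration.integral_cong refl)
    fix t :: real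
    show "indicator {0..} t * (of_real (w t) * (LINT \<tau>|lborel. H \<tau> * exp (Complex c \<tau> * of_real (ln (x / (1 + t))))))
        = (LINT \<tau>|lborel. ?f t \<tau>)"
      using x by (cases "t \<ge> 0") (simp_all add: ln_div)
  qed
  also have "\<dots> = (LINT \<tau>|lborel. LINT t|lborel. ?f t \<tau>)"
    by (rule lborel_pair.Fubini_integral[OF int, symmetric])
  finally show "(LINT t|lborel. indicator {0..} t * (of_real (w t) * (LINT \<tau>|lborel. H \<tau> * exp (Complex c \<tau> * of_real (ln (x / (1 + t)))))))
       = (LINT \<tau>|lborel. H \<tau> * k \<tau> * exp (Complex c \<tau> * of_real (ln x)))"
    unfolding inner .
qed

section \<open>Closing the contour: a Perron-type integral\<close>

text \<open>Segment and arc join the same endpoints inside a convex half-plane on which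
  \<open>f\<close> has a primitive.\<close>

lemma contour_segment_eq_right_arc:
  assumes "f holomorphic_on {z. Re z > d}" "c > d" "r > 0"
  shows "(f has_contour_integral contour_integral (linepath (Complex c (-r)) (Complex c r)) f)
    (part_circlepath (of_real c) r (- pi / 2) (pi / 2))"
proof -
  have S: "convex {z. Re z > d}" "open {z. Re z > d}"
    by (auto simp: convex_halfspace_Re_gt open_halfspace_Re_gt)
  obtain g where g: "\<And>z. z \<in> {z. Re z > d} \<Longrightarrow> (g has_field_derivative f z) (at z within {z. Re z > d})"
    using holomorphic_convex_primitive'[OF S assms(1)] by blast
  have im1: "path_image (linepath (Complex c (-r)) (Complex c r)) \<subseteq> {z. Re z > d}"
    using assms S by (intro closed_segment_subset[THEN order_trans[rotated], of _ "{z. Re z > d}"] ) auto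
  have im2: "path_image (part_circlepath (of_real c) r (- pi / 2) (pi / 2)) \<subseteq> {z. Re z > d}"
    using assms
    by (auto simp: path_image_part_circlepath' Re_exp closed_segment_eq_real_ivl intro!: add_less_le_mono[of d c 0, simplified] mult_nonneg_nonneg cos_ge_zero)
  have ends: "pathstart (part_circlepath (of_real c) r (- pi / 2) (pi / 2)) = Complex c (-r)"
      "pathfinish (part_circlepath (of_real c) r (- pi / 2) (pi / 2)) = Complex c r"
    by (simp_all add: complex_eq_iff Re_exp Im_exp)
  have "(f has_contour_integral (g (Complex c r) - g (Complex c (-r)))) (linepath (Complex c (-r)) (Complex c r))"
    using contour_integral_primitive[OF g _ im1] by simp
  moreover have "(f has_contour_integral (g (Complex c r) - g (Complex c (-r))))
      (part_circlepath (of_real c) r (- pi / 2) (pi / 2))"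
    using contour_integral_primitive[OF g valid_path_part_circlepath im2] unfolding ends .
  ultimately show ?thesis by (simp add: contour_integral_unique)
qed

text \<open>The circle is parametrised from angle 0, the right arc from -pi/2. Periodicity moves the
  piece over [3 pi/2, 2 pi] to [-pi/2, 0].\<close>

lemma circlepath_split_arcs:
  assumes "continuous_on (sphere z r) f" "r > 0"
    and "(f has_contour_integral I) (circlepath z r)"
  shows "I = contour_integral (part_circlepath z r (- pi / 2) (pi / 2)) f
           + contour_integral (part_circlepath z r (pi / 2) (3 * pi / 2)) f"
proof -
  let ?h = "\<lambda>t. f (z + r * cis t) * r * \<i> * cis t"
  have cis: "continuous_on A cis" for A by (intro continuous_intros) 
  have cont: "continuous_on A ?h" for A
    using assms(2)
    by (intro continuous_intros continuous_on_compose2[OF assms(1)] cis) (auto simp: dist_norm norm_mult)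
  have int: "?h integrable_on {a..b}" for a b by (intro integrable_continuous_real cont)
  have per: "integral {- pi / 2..0} ?h = integral {3 * pi / 2..2 * pi} ?h"
  proof -
    have "part_circlepath z r (- pi / 2) 0 = part_circlepath z r (3 * pi / 2) (2 * pi)"
    proof
      fix t
      have "\<i> * of_real (linepath (3 * pi / 2) (2 * pi) t) = \<i> * of_real (linepath (- pi / 2) 0 t) + 2 * of_real pi * \<i>"
        by (simp add: linepath_def complex_eq_iff field_simps)
      then have "exp (\<i> * of_real (linepath (3 * pi / 2) (2 * pi) t)) = exp (\<i> * of_real (linepath (- pi / 2) 0 t))"
        by (simp only: exp_add exp_two_pi_i) simp
      then show "part_circlepath z r (- pi / 2) 0 t = part_circlepath z r (3 * pi / 2) (2 * pi) t"
        by (simp add: part_circlepath_def of_real_linepath[symmetric] del: of_real_mult of_real_divide)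
    qed
    then show ?thesis
      by (subst (1 2) contour_integral_part_circlepath_eq[symmetric]) simp_all
  qed
  have "(?h has_integral I) {0..2 * pi}"
    using assms(3) unfolding circlepath_def
    by (subst (asm) has_contour_integral_part_circlepath_iff) auto
  then have "I = integral {0..2 * pi} ?h" by (simp add: integral_unique)
  also have "\<dots> = integral {0..3 * pi / 2} ?h + integral {3 * pi / 2..2 * pi} ?h"
    by (intro Henstock_Kurzweil_Integration.integral_combine[symmetric] int) auto
  also have "\<dots> = integral {- pi / 2..0} ?h + integral {0..3 * pi / 2} ?h"
    unfolding per by simp
  also have "\<dots> = integral {- pi / 2..3 * pi / 2} ?h"
    by (intro Henstock_Kurzweil_Integration.integral_combine int) auto
  also have "\<dots> = integral {- pi / 2..pi / 2} ?h + integral {pi / 2..3 * pi / 2} ?h"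
    by (intro Henstock_Kurzweil_Integration.integral_combine[symmetric] int) auto
  finally show ?thesis
    by (subst (1 2) contour_integral_part_circlepath_eq) simp_all
qed

text \<open>To the right of 1 one has |s| >= |s - 1|, hence |s (s - 1)| >= d^2 + t^2 with d = c - 1.
  The factor 1 + 1 / d^2 is what compares 1 / (d^2 + t^2) with 1 / (1 + t^2).\<close>

lemma integrable_line_inverse_quadratic:
  assumes c: "c > 1"
  shows "integrable lborel (\<lambda>t. 1 / (Complex c t * (Complex c t - 1)))"
proof (rule Bochner_Integration.integrable_bound)
  show "integrable lborel (\<lambda>t. (1 + 1 / (c - 1)^2) * inverse (1 + t\<^sup>2))"
    using integrable_inverse_1_plus_square
    by (intro integrable_mult_right) (simp add: set_integrable_def)
  have Cm [measurable]: "(\<lambda>\<tau>. Complex c \<tau>) \<in> borel_measurable borel"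
    unfolding Complex_eq by measurable
  show "(\<lambda>t. 1 / (Complex c t * (Complex c t - 1))) \<in> borel_measurable lborel" by measurable
  show "AE t in lborel. norm (1 / (Complex c t * (Complex c t - 1))) \<le> norm ((1 + 1 / (c - 1)^2) * inverse (1 + t\<^sup>2))"
  proof (intro AE_I2)
    fix t :: real
    define d where "d = c - 1"
    have d: "d > 0" using c by (simp add: d_def)
    have n1: "norm (Complex c t - 1) ^ 2 = d\<^sup>2 + t\<^sup>2"
      by (simp add: cmod_power2 d_def)
    have "norm (Complex c t - 1) \<le> norm (Complex c t)"
      unfolding cmod_def using c by (intro real_sqrt_le_mono add_mono) (auto intro!: power_mono)
    then have "norm (Complex c t - 1) ^ 2 \<le> norm (Complex c t) * norm (Complex c t - 1)"
      by (simp add: power2_eq_square mult_right_mono)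
    then have le: "d\<^sup>2 + t\<^sup>2 \<le> norm (Complex c t * (Complex c t - 1))"
      by (simp add: n1 norm_mult)
    have pos: "d\<^sup>2 + t\<^sup>2 > 0" using d by (simp add: add_pos_nonneg)
    have "norm (1 / (Complex c t * (Complex c t - 1))) \<le> 1 / (d\<^sup>2 + t\<^sup>2)"
      unfolding norm_divide norm_one using le pos by (intro divide_left_mono mult_pos_pos) linarith+
    also have "\<dots> \<le> (1 + 1 / d\<^sup>2) / (1 + t\<^sup>2)"
      using d pos by (simp add: divide_simps add_pos_nonneg) (simp add: algebra_simps)
    finally show "norm (1 / (Complex c t * (Complex c t - 1))) \<le> norm ((1 + 1 / (c - 1)^2) * inverse (1 + t\<^sup>2))"
      by (simp add: d_def divide_inverse)
  qed
qed

text \<open>One estimate for both half circles: on the circle both poles are at distance at least r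
  - c, and \<open>le\<close> holds on the right half if u <= 0 and on the left half if u >=
  0.\<close>

lemma norm_exp_over_quadratic_le:
  assumes c: "c > 1" and r: "r > c" and z: "dist (of_real c) z = r"
    and le: "Re z * u \<le> c * u"
  shows "norm (exp (z * of_real u) / (z * (z - 1))) \<le> exp (c * u) / (r - c)\<^sup>2"
proof -
  have zc: "norm (z - of_real c) = r" using z by (simp add: dist_norm norm_minus_commute)
  have "r \<le> norm z + c"
    using norm_triangle_ineq4[of z "of_real c"] zc c by simp
  moreover have "r \<le> norm (z - 1) + (c - 1)"
    using norm_triangle_ineq4[of "z - 1" "of_real (c - 1)"] zc c by (simp del: of_real_diff) simp
  ultimately have "(r - c) * (r - c) \<le> norm z * norm (z - 1)"
    using r c by (intro mult_mono) auto
  then show ?thesis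
    unfolding norm_divide norm_mult power2_eq_square using le r
    by (intro frac_le) (auto simp: norm_exp_eq_Re)
qed

text \<open>Closing the line by the right half circle for \<open>u \<le> 0\<close> and by the left one, which picks up
  the poles 0 and 1, for \<open>u \<ge> 0\<close>.\<close>
lemma perron_quadratic:
  assumes c: "c > 1"
  shows "(LINT t|lborel. 1 / (Complex c t * (Complex c t - 1)) * exp (Complex c t * of_real u))
       = of_real (2 * pi * max 0 (exp u - 1))"
proof -
  define f :: "complex \<Rightarrow> complex" where "f = (\<lambda>z. exp (z * of_real u) / (z * (z - 1)))"
  define seg where "seg = (\<lambda>r. contour_integral (linepath (Complex c (-r)) (Complex c r)) f)"
  define J where "J = (LINT t|lborel. f (Complex c t))"
  have Cm [measurable]: "(\<lambda>\<tau>. Complex c \<tau>) \<in> borel_measurable borel"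
    unfolding Complex_eq by measurable
  have intf: "integrable lborel (\<lambda>t. f (Complex c t))"
  proof (rule Bochner_Integration.integrable_bound)
    show "integrable lborel (\<lambda>t. exp (c * u) *\<^sub>R (1 / (Complex c t * (Complex c t - 1))))"
      using integrable_line_inverse_quadratic[OF c] by (rule integrable_scaleR_right)
    show "(\<lambda>t. f (Complex c t)) \<in> borel_measurable lborel" unfolding f_def by measurable
  qed (simp add: f_def norm_divide norm_mult)
  have line_nz: "Complex c t \<noteq> 0" "Complex c t \<noteq> 1" for t
    using c by (auto simp: complex_eq_iff)
  have cont: "continuous_on A (\<lambda>t. f (Complex c t))" for A
  proof -
    have "continuous_on A (\<lambda>t. Complex c t)" unfolding Complex_eq by (intro continuous_intros)
    then show ?thesis
      unfolding f_def by (intro continuous_intros) (simp_all add: line_nz del: Complex_eq_0 Complex_eq_1)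
  qed
  \<comment> \<open>The factor i comes from ds = i dt.\<close>
  have seg: "seg r = \<i> * (LINT t|lborel. indicator {-r..r} t *\<^sub>R f (Complex c t))" if "r > 0" for r
  proof -
    have "seg r = \<i> * integral {-r..r} (\<lambda>t. f (Complex c t))"
      unfolding seg_def using that by (intro contour_integral_linepath_same_Re) auto
    also have "integral {-r..r} (\<lambda>t. f (Complex c t)) = set_lebesgue_integral lborel {-r..r} (\<lambda>t. f (Complex c t))"
      by (intro set_borel_integral_eq_integral(2)[symmetric] borel_integrable_atLeastAtMost' cont)
    finally show ?thesis by (simp add: set_lebesgue_integral_def)
  qed
  have lim: "((\<lambda>r. seg r) \<longlongrightarrow> \<i> * J) at_top"
  proof -
    have "((\<lambda>r. LINT t|lborel. indicator {-r..r} t *\<^sub>R f (Complex c t)) \<longlongrightarrow> J) at_top"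
      unfolding J_def
    proof (rule integral_dominated_convergence_at_top[where w="\<lambda>t. norm (f (Complex c t))"])
      show "(\<lambda>t. f (Complex c t)) \<in> borel_measurable lborel" using intf by auto
      show "AE t in lborel. ((\<lambda>r. indicator {-r..r} t *\<^sub>R f (Complex c t)) \<longlongrightarrow> f (Complex c t)) at_top"
      proof (intro AE_I2 tendsto_eventually)
        fix t :: real
        show "\<forall>\<^sub>F r in at_top. indicator {-r..r} t *\<^sub>R f (Complex c t) = f (Complex c t)"
          using eventually_ge_at_top[of "\<bar>t\<bar>"] by eventually_elim (auto simp: indicator_def)
      qed
    qed (use intf in \<open>auto simp: indicator_def intro!: always_eventually\<close>)
    then have "((\<lambda>r. \<i> * (LINT t|lborel. indicator {-r..r} t *\<^sub>R f (Complex c t))) \<longlongrightarrow> \<i> * J) at_top"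
      by (intro tendsto_intros)
    then show ?thesis
      by (rule Lim_transform_eventually)
         (use eventually_gt_at_top[of 0] in eventually_elim, simp add: seg)
  qed
  define ra where "ra = (\<lambda>r. contour_integral (part_circlepath (of_real c) r (- pi / 2) (pi / 2)) f)"
  define la where "la = (\<lambda>r. contour_integral (part_circlepath (of_real c) r (pi / 2) (3 * pi / 2)) f)"
  have "f holomorphic_on {z. Re z > 1}"
    unfolding f_def by (intro holomorphic_intros) auto
  then have seg_ra: "(f has_contour_integral seg r) (part_circlepath (of_real c) r (- pi / 2) (pi / 2))" if "r > 0" for r
    unfolding seg_def using contour_segment_eq_right_arc[OF _ c that] by blast
  \<comment> \<open>The sup bound times the length pi r of a half circle; it decays like 1 /
    r.\<close>
  have small: "((\<lambda>r. exp (c * u) / (r - c)\<^sup>2 * r * pi) \<longlongrightarrow> 0) at_top" by real_asymp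
  have d0: "dist (complex_of_real c) 0 = c" and d1: "dist (complex_of_real c) 1 = c - 1"
    using c dist_of_real[of c 1, where 'a=complex] by (auto simp: dist_real_def)
  have nz: "z \<noteq> 0 \<and> z \<noteq> 1" if "z \<in> sphere (complex_of_real c) r" "r > c" for z r
    using that c d0 d1 by auto
  have contf: "continuous_on (sphere (of_real c) r) f" if "r > c" for r
    unfolding f_def using nz that by (intro continuous_intros) auto
  have J: "\<i> * J = 2 * of_real pi * \<i> * of_real (max 0 (exp u - 1))"
  proof (cases "u \<le> 0")
    case True
    have "((\<lambda>r. seg r) \<longlongrightarrow> 0) at_top"
    proof (rule tendsto_0_le[OF small, of _ 1])
      show "\<forall>\<^sub>F r in at_top. norm (seg r) \<le> norm (exp (c * u) / (r - c)\<^sup>2 * r * pi) * 1"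
        using eventually_gt_at_top[of c]
      proof eventually_elim
        case (elim r)
        have "norm (seg r) \<le> exp (c * u) / (r - c)\<^sup>2 * r * (pi / 2 - (- pi / 2))"
        proof (rule has_contour_integral_bound_part_circlepath[OF seg_ra])
          fix z assume z: "z \<in> path_image (part_circlepath (of_real c) r (- pi / 2) (pi / 2))"
          have "Re z \<ge> c" using z elim c
            by (auto simp: path_image_part_circlepath' Re_exp closed_segment_eq_real_ivl intro!: mult_nonneg_nonneg cos_ge_zero)
          moreover have "z \<in> sphere (of_real c) r"
            using z path_image_part_circlepath_subset[of "- pi / 2" "pi / 2" r "of_real c"] elim c by auto
          ultimately show "norm (f z) \<le> exp (c * u) / (r - c)\<^sup>2"
            unfolding f_def using True elim by (intro norm_exp_over_quadratic_le c) (auto intro: mult_right_mono_neg)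
        qed (use elim c in auto)
        also have "pi / 2 - (- pi / 2) = pi" by simp
        also have "exp (c * u) / (r - c)\<^sup>2 * r * pi \<le> norm (exp (c * u) / (r - c)\<^sup>2 * r * pi) * 1"
          by (simp only: mult_1_right real_norm_def abs_ge_self)
        finally show ?case .
      qed
    qed
    with lim have "\<i> * J = 0" by (rule tendsto_unique[rotated]) simp
    then show ?thesis using True by (simp add: max_def)
  next
    case False
    have la0: "((\<lambda>r. la r) \<longlongrightarrow> 0) at_top"
    proof (rule tendsto_0_le[OF small, of _ 1])
      show "\<forall>\<^sub>F r in at_top. norm (la r) \<le> norm (exp (c * u) / (r - c)\<^sup>2 * r * pi) * 1"
        using eventually_gt_at_top[of c]
      proof eventually_elim
        case (elim r)
        have sub: "path_image (part_circlepath (of_real c) r (pi / 2) (3 * pi / 2)) \<subseteq> sphere (of_real c) r"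
          using elim c by (intro path_image_part_circlepath_subset) auto
        have "norm (la r) \<le> exp (c * u) / (r - c)\<^sup>2 * r * (3 * pi / 2 - pi / 2)"
        proof (rule has_contour_integral_bound_part_circlepath)
          show "(f has_contour_integral la r) (part_circlepath (of_real c) r (pi / 2) (3 * pi / 2))"
            unfolding la_def
            by (intro has_contour_integral_integral contour_integrable_continuous_part_circlepath
                  continuous_on_subset[OF contf[OF elim] sub])
          fix z assume z: "z \<in> path_image (part_circlepath (of_real c) r (pi / 2) (3 * pi / 2))"
          \<comment> \<open>A shift by pi reduces this to the sign of the cosine on
            [-pi/2, pi/2].\<close>
          have cosn: "cos t \<le> 0" if "pi / 2 \<le> t" "t \<le> 3 * pi / 2" for t
            using cos_ge_zero[of "t - pi"] that by (simp add: cos_diff)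
          have "Re z \<le> c" using z elim c
            by (auto simp: path_image_part_circlepath' Re_exp closed_segment_eq_real_ivl intro!: mult_nonneg_nonpos cosn)
          then show "norm (f z) \<le> exp (c * u) / (r - c)\<^sup>2"
            unfolding f_def using False elim z sub by (intro norm_exp_over_quadratic_le c) (auto intro: mult_right_mono)
        qed (use elim c in auto)
        also have "3 * pi / 2 - pi / 2 = pi" by simp
        also have "exp (c * u) / (r - c)\<^sup>2 * r * pi \<le> norm (exp (c * u) / (r - c)\<^sup>2 * r * pi) * 1"
          by (simp only: mult_1_right real_norm_def abs_ge_self)
        finally show ?case .
      qed
    qed
    \<comment> \<open>The segment has the same integral as the right arc, so segment plus left arc
      amounts to the full circle. Partial fractions 1 / (z (z - 1)) = 1 / (z - 1) - 1 / z and the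
      Cauchy formula then give e^u - 1.\<close>
    have closed: "seg r + la r = 2 * of_real pi * \<i> * of_real (exp u - 1)" if r: "r > c" for r
    proof -
      let ?e = "\<lambda>z. exp (z * of_real u)"
      have "((\<lambda>z. ?e z / (z - 1) - ?e z / (z - 0)) has_contour_integral
          (2 * of_real pi * \<i> * ?e 1 - 2 * of_real pi * \<i> * ?e 0)) (circlepath (of_real c) r)"
        using r c d0 d1
        by (intro has_contour_integral_diff Cauchy_integral_circlepath_simple holomorphic_intros)
           (auto simp: dist_norm norm_minus_commute)
      then have "(f has_contour_integral (2 * of_real pi * \<i> * ?e 1 - 2 * of_real pi * \<i> * ?e 0)) (circlepath (of_real c) r)"
        by (rule has_contour_integral_eq)
           (use nz[OF _ r] r c in \<open>auto simp: f_def divide_simps algebra_simps\<close>)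
      from circlepath_split_arcs[OF contf[OF r] _ this]
      have "seg r + la r = 2 * of_real pi * \<i> * ?e 1 - 2 * of_real pi * \<i> * ?e 0"
        using r c seg_ra[of r] by (simp add: la_def contour_integral_unique)
      then show ?thesis by (simp add: exp_of_real algebra_simps)
    qed
    have "\<forall>\<^sub>F r in at_top. 2 * of_real pi * \<i> * of_real (exp u - 1) = seg r + la r"
      using eventually_gt_at_top[of c] by eventually_elim (simp only: closed)
    then have "((\<lambda>r. seg r + la r) \<longlongrightarrow> 2 * of_real pi * \<i> * of_real (exp u - 1)) at_top"
      by (rule Lim_transform_eventually[OF tendsto_const])
    moreover have "((\<lambda>r. seg r + la r) \<longlongrightarrow> \<i> * J + 0) at_top"
      by (intro tendsto_add lim la0)
    ultimately have "\<i> * J = 2 * of_real pi * \<i> * of_real (exp u - 1)"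
      using tendsto_unique[OF trivial_limit_at_top_linorder] by fastforce
    then show ?thesis using False by (simp add: max_def)
  qed
  have "J = of_real (2 * pi * max 0 (exp u - 1))"
  proof -
    have "\<i> * J = \<i> * of_real (2 * pi * max 0 (exp u - 1))" unfolding J by simp
    then show ?thesis by (simp only: mult_left_cancel complex_i_not_zero not_False_eq_True)
  qed
  then show ?thesis by (simp add: J_def f_def)
qed

section \<open>Mellin-Barnes integrals of the region moments\<close>

lemma integral_power_Icc_max:
  "(LINT y|lborel. indicator {0..A} y * y ^ n) = (max 0 A) ^ Suc n / real (Suc n)"
proof (cases "A \<ge> 0")
  case True
  then show ?thesis using integral_power[of 0 A n] by (simp add: mult.commute max_def)
next
  case False
  then have "indicator {0..A} y * y ^ n = 0" for y :: real by (auto simp: indicator_def)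
  then show ?thesis using False by simp
qed

lemma region_moment_singleton:
  "region_moment {i} b x = (max 0 (x - 1)) ^ Suc (b i) / real (Suc (b i))"
proof -
  have "region_moment {i} b x = (LINT t|PiM {i} (\<lambda>_. lborel). (\<lambda>y. indicator {0..x - 1} y * y ^ b i) (t i))"
    unfolding region_moment_def
    by (intro Bochner_Integration.integral_cong refl) (auto simp: hyperbolic_region_def indicator_def)
  also have "\<dots> = (LINT y|lborel. indicator {0..x - 1} y * y ^ b i)"
    by (rule lborel_product.product_integral_singleton) measurable
  finally show ?thesis by (simp only: integral_power_Icc_max)
qed

lemma not_nonpos_Ints_Re_pos: "Re z > 0 \<Longrightarrow> z \<notin> \<int>\<^sub>\<le>\<^sub>0"
  by (auto elim!: nonpos_Ints_cases)

text \<open>On the right stands the one-variable region moment divided by \<open>fact b\<close>. In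
  the induction the weight (1 + t)^n cancels the denominator of (x / (1 + t) - 1)^n, leaving (x - 1
  - t)^n to be integrated over [0, x - 1].\<close>

lemma mellin_barnes_single:
  assumes "real (Suc b) < c"
  shows "integrable lborel (\<lambda>\<tau>. Gamma (Complex c \<tau> - of_nat (Suc b)) / (Complex c \<tau> * Gamma (Complex c \<tau>))) \<and>
    (\<forall>x>0. (LINT \<tau>|lborel. Gamma (Complex c \<tau> - of_nat (Suc b)) / (Complex c \<tau> * Gamma (Complex c \<tau>)) * exp (Complex c \<tau> * of_real (ln x)))
      = of_real (2 * pi * (max 0 (x - 1)) ^ Suc b / fact (Suc b)))"
  using assms
proof (induction b)
  case 0
  then have c: "c > 1" by simp
  have eq: "Gamma (Complex c \<tau> - of_nat (Suc 0)) / (Complex c \<tau> * Gamma (Complex c \<tau>)) = 1 / (Complex c \<tau> * (Complex c \<tau> - 1))" for \<tau>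
  proof -
    have nz: "Complex c \<tau> - 1 \<notin> \<int>\<^sub>\<le>\<^sub>0" using c by (intro not_nonpos_Ints_Re_pos) simp
    then have "Gamma (Complex c \<tau> - 1) \<noteq> 0" by (simp only: Gamma_eq_zero_iff not_False_eq_True)
    moreover have "Gamma (Complex c \<tau>) = (Complex c \<tau> - 1) * Gamma (Complex c \<tau> - 1)"
      using Gamma_plus1[OF nz] by (simp only: diff_add_cancel)
    ultimately show ?thesis by simp
  qed
  show ?case
    unfolding eq using integrable_line_inverse_quadratic[OF c] perron_quadratic[OF c] by simp
next
  case (Suc b)
  let ?n = "Suc b"
  let ?H = "\<lambda>\<tau>. Gamma (Complex c \<tau> - of_nat ?n) / (Complex c \<tau> * Gamma (Complex c \<tau>))"
  let ?k = "\<lambda>\<tau>. 1 / (Complex c \<tau> - of_nat (Suc ?n))"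
  have c': "real ?n < c" "real (Suc ?n) < c" using Suc.prems by auto
  have Hint: "integrable lborel ?H" using Suc.IH[OF c'(1)] by blast
  have k: "(LINT t|lborel. indicator {0..} t * (of_real ((1 + t) ^ ?n) * exp (- Complex c \<tau> * of_real (ln (1 + t))))) = ?k \<tau>" for \<tau>
  proof -
    have "(LINT t|lborel. indicator {0..} t * (of_real ((1 + t) ^ ?n) * exp (- Complex c \<tau> * of_real (ln (1 + t)))))
        = (LINT t|lborel. indicator {0..} t * exp (- (Complex c \<tau> - of_nat ?n) * of_real (ln (1 + t))))"
    proof (intro Bochner_Integration.integral_cong refl)
      fix t :: real
      have "exp (- (Complex c \<tau> - of_nat ?n) * of_real (ln (1 + t))) = of_real ((1 + t) ^ ?n) * exp (- Complex c \<tau> * of_real (ln (1 + t)))" if "t \<ge> 0"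
      proof -
        have "- (p - q) * z = q * z + - p * z" for p q z :: complex
          by (simp add: algebra_simps)
        then have "- (Complex c \<tau> - of_nat ?n) * of_real (ln (1 + t)) = of_nat ?n * of_real (ln (1 + t)) + - Complex c \<tau> * of_real (ln (1 + t))" .
        moreover have "exp (of_nat ?n * complex_of_real (ln (1 + t))) = of_real ((1 + t) ^ ?n)"
          using that by (simp only: exp_of_nat_mult exp_of_real of_real_power) simp
        ultimately show ?thesis by (simp only: exp_add)
      qed
      then show "indicator {0..} t * (of_real ((1 + t) ^ ?n) * exp (- Complex c \<tau> * of_real (ln (1 + t))))
          = indicator {0..} t * exp (- (Complex c \<tau> - of_nat ?n) * of_real (ln (1 + t)))"
        by (cases "t \<ge> 0") simp_all
    qed
    also have "\<dots> = 1 / (Complex c \<tau> - of_nat ?n - 1)"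
      using c' by (intro integral_one_plus_powr_complex) simp
    finally show ?thesis by (simp add: algebra_simps)
  qed
  have w: "integrable lborel (\<lambda>t. indicator {0..} t * ((1 + t) ^ ?n * (1 + t) powr (- c)))"
  proof -
    have "integrable lborel (\<lambda>t. indicator {0..} t * (1 + t) powr (- (c - real ?n)))"
      using c' by (intro lborel_integrable_one_plus_powr) auto
    moreover have "indicator {0..} t * (1 + t) powr (- (c - real ?n)) = indicator {0..} t * ((1 + t) ^ ?n * (1 + t) powr (- c))" for t :: real
    proof (cases "t \<ge> 0")
      case True
      then have "(1 + t) ^ ?n = (1 + t) powr real ?n" by (intro powr_realpow[symmetric]) auto
      moreover have "- (c - real ?n) = real ?n + - c" by simp
      ultimately show ?thesis by (simp only: powr_add)
    qed simp
    ultimately show ?thesis by (simp only: )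
  qed
  have Hk: "?H \<tau> * ?k \<tau> = Gamma (Complex c \<tau> - of_nat (Suc ?n)) / (Complex c \<tau> * Gamma (Complex c \<tau>))" for \<tau>
  proof -
    let ?z = "Complex c \<tau> - of_nat (Suc ?n)"
    have "Re ?z > 0" using c' by simp
    then have nz: "?z \<notin> \<int>\<^sub>\<le>\<^sub>0" by (rule not_nonpos_Ints_Re_pos)
    then have nz': "?z \<noteq> 0" by (metis zero_in_nonpos_Ints)
    have "?z + 1 = Complex c \<tau> - of_nat ?n" by simp
    then have "Gamma (Complex c \<tau> - of_nat ?n) = ?z * Gamma ?z"
      using Gamma_plus1[OF nz] by (simp only: )
    moreover have "z \<noteq> 0 \<Longrightarrow> z * g / d * (1 / z) = g / d" for z g d :: complex by simp
    ultimately show ?thesis using nz' by (simp only: )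
  qed
  note conv = complex_mellin_convolution[OF Hint _ w _ k]
  show ?case
  proof (intro conjI allI impI)
    show "integrable lborel (\<lambda>\<tau>. Gamma (Complex c \<tau> - of_nat (Suc ?n)) / (Complex c \<tau> * Gamma (Complex c \<tau>)))"
      using conv(1)[of 1] by (simp only: Hk) simp
    fix x :: real assume x: "x > 0"
    have "(LINT \<tau>|lborel. ?H \<tau> * ?k \<tau> * exp (Complex c \<tau> * of_real (ln x)))
        = (LINT t|lborel. indicator {0..} t * (of_real ((1 + t) ^ ?n) * (LINT \<tau>|lborel. ?H \<tau> * exp (Complex c \<tau> * of_real (ln (x / (1 + t)))))))"
      by (rule conv(2)[symmetric]) (use x in simp_all)
    also have "\<dots> = (LINT t|lborel. of_real (indicator {0..x - 1} t * (x - 1 - t) ^ ?n * (2 * pi / fact ?n)))"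
    proof (intro Bochner_Integration.integral_cong refl)
      fix t :: real
      show "indicator {0..} t * (of_real ((1 + t) ^ ?n) * (LINT \<tau>|lborel. ?H \<tau> * exp (Complex c \<tau> * of_real (ln (x / (1 + t))))))
          = of_real (indicator {0..x - 1} t * (x - 1 - t) ^ ?n * (2 * pi / fact ?n))"
      proof (cases "t \<ge> 0")
        case True
        have "(1 + t) ^ ?n * (max 0 (x / (1 + t) - 1)) ^ ?n = ((1 + t) * max 0 (x / (1 + t) - 1)) ^ ?n"
          by (rule power_mult_distrib[symmetric])
        also have "(1 + t) * max 0 (x / (1 + t) - 1) = max 0 (x - 1 - t)"
        proof -
          have "(1 + t) * (x / (1 + t) - 1) = x - 1 - t" using True by (simp add: right_diff_distrib)
          then show ?thesis using True by (simp only: max_mult_distrib_left) simp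
        qed
        also have "\<dots> ^ ?n = indicator {0..x - 1} t * (x - 1 - t) ^ ?n"
          using True by (auto simp: max_def indicator_def)
        finally have e: "(1 + t) ^ ?n * (max 0 (x / (1 + t) - 1)) ^ ?n = indicator {0..x - 1} t * (x - 1 - t) ^ ?n" .
        have "(LINT \<tau>|lborel. ?H \<tau> * exp (Complex c \<tau> * of_real (ln (x / (1 + t))))) = of_real (2 * pi * (max 0 (x / (1 + t) - 1)) ^ ?n / fact ?n)"
          using True x Suc.IH[OF c'(1)] by simp
        moreover have "(1 + t) ^ ?n * (2 * pi * (max 0 (x / (1 + t) - 1)) ^ ?n / fact ?n) = indicator {0..x - 1} t * (x - 1 - t) ^ ?n * (2 * pi / fact ?n)"
          unfolding e[symmetric] by (simp only: divide_inverse mult_ac)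
        ultimately show ?thesis using True by (simp only: of_real_mult[symmetric] indicator_simps atLeast_iff) simp
      qed simp
    qed
    also have "\<dots> = of_real (LINT t|lborel. indicator {0..x - 1} t * (x - 1 - t) ^ ?n * (2 * pi / fact ?n))"
      by (rule integral_complex_of_real)
    also have "(LINT t|lborel. indicator {0..x - 1} t * (x - 1 - t) ^ ?n * (2 * pi / fact ?n)) = (LINT t|lborel. indicator {0..x - 1} t * t ^ ?n) * (2 * pi / fact ?n)"
    proof -
      \<comment> \<open>The substitution t -> x - 1 - t maps the interval to itself.\<close>
      have "(LINT t|lborel. indicator {0..x - 1} t * t ^ ?n) = (LINT t|lborel. indicator {0..x - 1} (x - 1 + - 1 * t) * (x - 1 + - 1 * t) ^ ?n)"
        using lborel_integral_real_affine[of "-1" "\<lambda>t. indicator {0..x - 1} t * t ^ ?n" "x - 1"] by simp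
      also have "\<dots> = (LINT t|lborel. indicator {0..x - 1} t * (x - 1 - t) ^ ?n)"
        by (intro Bochner_Integration.integral_cong refl) (auto simp: indicator_def)
      finally show ?thesis by (simp only: integral_mult_left_zero)
    qed
    also have "\<dots> = 2 * pi * (max 0 (x - 1)) ^ Suc ?n / fact (Suc ?n)"
      unfolding integral_power_Icc_max fact_Suc[of ?n] by (simp only: times_divide_times_eq of_nat_mult) (simp only: mult_ac)
    finally show "(LINT \<tau>|lborel. Gamma (Complex c \<tau> - of_nat (Suc ?n)) / (Complex c \<tau> * Gamma (Complex c \<tau>)) * exp (Complex c \<tau> * of_real (ln x)))
        = of_real (2 * pi * (max 0 (x - 1)) ^ Suc ?n / fact (Suc ?n))" unfolding Hk .
  qed
qed

text \<open>Inserting an index multiplies \<open>H\<close> by one Beta quotient. By the convolution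
  this integrates t^b against the previous result at x / (1 + t), and
  \<open>region_moment_insert\<close> is the same recursion for the region moments.\<close>

lemma mellin_barnes_region_moment:
  assumes "finite I" "I \<noteq> {}" and "\<And>k. k \<in> I \<Longrightarrow> real (Suc (b k)) < c"
  defines "H \<equiv> \<lambda>I \<tau>. (\<Prod>k\<in>I. Gamma (of_nat (Suc (b k))) * Gamma (Complex c \<tau> - of_nat (Suc (b k))) / Gamma (Complex c \<tau>)) / Complex c \<tau>"
  shows "integrable lborel (H I) \<and> (\<forall>x>0. (LINT \<tau>|lborel. H I \<tau> * exp (Complex c \<tau> * of_real (ln x))) = of_real (2 * pi * region_moment I b x))"
  using assms(1-3)
proof (induction rule: finite_ne_induct)
  case (singleton i)
  have H: "H {i} \<tau> = fact (b i) * (Gamma (Complex c \<tau> - of_nat (Suc (b i))) / (Complex c \<tau> * Gamma (Complex c \<tau>)))" for \<tau>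
    using Gamma_fact[of "b i", where 'a=complex] by (simp add: H_def add.commute mult.commute)
  have c: "real (Suc (b i)) < c" using singleton by simp
  show ?case
  proof (intro conjI allI impI)
    show "integrable lborel (H {i})" unfolding H using mellin_barnes_single[OF c] by (intro integrable_mult_right) blast
    fix x :: real assume x: "x > 0"
    have "(LINT \<tau>|lborel. H {i} \<tau> * exp (Complex c \<tau> * of_real (ln x))) = fact (b i) * of_real (2 * pi * (max 0 (x - 1)) ^ Suc (b i) / fact (Suc (b i)))"
      unfolding H mult.assoc integral_mult_right_zero using mellin_barnes_single[OF c] x by (simp only: mult.assoc)
    also have "\<dots> = of_real (fact (b i) * (2 * pi * (max 0 (x - 1)) ^ Suc (b i) / fact (Suc (b i))))"
      by (simp only: of_real_mult of_real_fact)
    also have "fact (b i) * (2 * pi * (max 0 (x - 1)) ^ Suc (b i) / fact (Suc (b i))) = 2 * pi * region_moment {i} b x"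
      unfolding region_moment_singleton fact_Suc by (simp add: field_simps del: of_nat_Suc)
    finally show "(LINT \<tau>|lborel. H {i} \<tau> * exp (Complex c \<tau> * of_real (ln x))) = of_real (2 * pi * region_moment {i} b x)" .
  qed
next
  case (insert i I)
  let ?k = "\<lambda>\<tau>. Gamma (of_nat (Suc (b i))) * Gamma (Complex c \<tau> - of_nat (Suc (b i))) / Gamma (Complex c \<tau>)"
  have IH: "integrable lborel (H I)" "\<And>x. x > 0 \<Longrightarrow> (LINT \<tau>|lborel. H I \<tau> * exp (Complex c \<tau> * of_real (ln x))) = of_real (2 * pi * region_moment I b x)"
    using insert.IH insert.prems by auto
  have c: "real (Suc (b i)) < c" using insert.prems by simp
  have H: "H I \<tau> * ?k \<tau> = H (insert i I) \<tau>" for \<tau>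
    using insert.hyps by (simp add: H_def mult.commute del: of_nat_Suc)
  \<comment> \<open>The weight is the modulus of the complex kernel at the real point s = c.\<close>
  have w: "integrable lborel (\<lambda>t. indicator {0..} t * (t ^ b i * (1 + t) powr (- c)))"
  proof -
    have "integrable lborel (\<lambda>t. norm (indicator {0..} t * (of_real (t ^ b i) * exp (- of_real c * of_real (ln (1 + t)))) :: complex))"
      using c by (intro integrable_norm integrable_shifted_power_kernel) simp
    moreover have "norm (indicator {0..} t * (of_real (t ^ b i) * exp (- of_real c * of_real (ln (1 + t)))) :: complex) = indicator {0..} t * (t ^ b i * (1 + t) powr (- c))" for t
      by (cases "t \<ge> 0") (simp_all add: norm_mult norm_power powr_def)
    ultimately show ?thesis by (simp only: )
  qed
  have k: "(LINT t|lborel. indicator {0..} t * (of_real (t ^ b i) * exp (- Complex c \<tau> * of_real (ln (1 + t))))) = ?k \<tau>" for \<tau>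
    using c by (intro integral_shifted_power_kernel) simp
  note conv = complex_mellin_convolution[OF IH(1) _ w _ k]
  show ?case
  proof (intro conjI allI impI)
    show "integrable lborel (H (insert i I))" using conv(1)[of 1] by (simp only: H) simp
    fix x :: real assume x: "x > 0"
    have "(LINT \<tau>|lborel. H (insert i I) \<tau> * exp (Complex c \<tau> * of_real (ln x)))
        = (LINT t|lborel. indicator {0..} t * (of_real (t ^ b i) * (LINT \<tau>|lborel. H I \<tau> * exp (Complex c \<tau> * of_real (ln (x / (1 + t)))))))"
      unfolding H[symmetric] by (rule conv(2)[symmetric]) (use x in simp_all)
    also have "\<dots> = (LINT t|lborel. of_real (2 * pi * (indicator {0..} t * (t ^ b i * region_moment I b (x / (1 + t))))))"
    proof (intro Bochner_Integration.integral_cong refl)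
      fix t :: real
      show "indicator {0..} t * (of_real (t ^ b i) * (LINT \<tau>|lborel. H I \<tau> * exp (Complex c \<tau> * of_real (ln (x / (1 + t))))))
          = complex_of_real (2 * pi * (indicator {0..} t * (t ^ b i * region_moment I b (x / (1 + t)))))"
        using x by (cases "t \<ge> 0") (simp_all add: IH(2))
    qed
    also have "\<dots> = of_real (LINT t|lborel. 2 * pi * (indicator {0..} t * (t ^ b i * region_moment I b (x / (1 + t)))))"
      by (rule integral_complex_of_real)
    also have "\<dots> = of_real (2 * pi * region_moment (insert i I) b x)"
      unfolding region_moment_insert[OF insert.hyps(1,3)] by (simp only: integral_mult_right_zero)
    finally show "(LINT \<tau>|lborel. H (insert i I) \<tau> * exp (Complex c \<tau> * of_real (ln x))) = of_real (2 * pi * region_moment (insert i I) b x)" .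
  qed
qed

section \<open>Identification with the Meijer G-function\<close>

lemma g_fun_eq_region_moment: "g_fun K m l x = region_moment {1..K} (\<lambda>k. m + l k - 1) x"
  by (simp add: g_fun_def region_moment_def hyperbolic_region_def)

text \<open>The leading upper parameter 1 contributes Gamma(s) and the others Gamma(s - m - l_k).
  The lower parameters 1 contribute 1 / Gamma(s) each, and the lower parameter 0 contributes 1 /
  Gamma(1 + s) = 1 / (s Gamma(s)). The first Gamma(s) cancels against the last one, leaving K Beta
  quotients and a single 1 / s.\<close>

lemma g_fun_eq_meijerG:
  assumes K: "K \<ge> 1" and m: "m \<ge> 1" and x: "x > 0"
  shows "complex_of_real (g_fun K m l x) = complex_of_real (\<Prod>k\<in>{1..K}. Gamma (real (m + l k)))
    * meijerG 0 (K + 1) (1 # map (\<lambda>k. of_nat (1 + l k + m)) [1..<K+1]) (replicate K 1 @ [0]) x"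
proof -
  define as :: "complex list" where "as = 1 # map (\<lambda>k. of_nat (1 + l k + m)) [1..<K+1]"
  define bs :: "complex list" where "bs = replicate K 1 @ [0]"
  have len: "length as = K + 1" "length bs = K + 1" by (simp_all add: as_def bs_def)
  have as0: "as ! 0 = 1" by (simp add: as_def)
  have as_Suc: "as ! Suc j = of_nat (1 + l (Suc j) + m)" if "j < K" for j
    using that by (simp add: as_def del: upt_Suc)
  have bs_nth: "bs ! j = (if j < K then 1 else 0)" if "j < K + 1" for j
    using that by (auto simp: bs_def nth_append)
  \<comment> \<open>This is the very abscissa selected inside \<open>meijerG\<close>; its
    admissibility follows once some admissible line exists.\<close>
  define c where "c = (SOME c. meijerG_admissible 0 (K + 1) as bs c)"
  have adm: "meijerG_admissible 0 (K + 1) as bs c"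
    unfolding c_def
  proof (rule someI)
    \<comment> \<open>One more than m plus the sum of all l_k, hence beyond every m + l_k and beyond
      0.\<close>
    show "meijerG_admissible 0 (K + 1) as bs (1 + real m + (\<Sum>k\<in>{1..K}. real (l k)))"
      unfolding meijerG_admissible_def
    proof (intro conjI allI impI)
      fix j assume j: "j < K + 1"
      show "Re (as ! j) - 1 < 1 + real m + (\<Sum>k\<in>{1..K}. real (l k))"
      proof (cases j)
        case 0
        have "0 \<le> (\<Sum>k\<in>{1..K}. real (l k))" by (intro sum_nonneg) auto
        then show ?thesis using 0 by (simp add: as0)
      next
        case (Suc i)
        have "real (l (Suc i)) \<le> (\<Sum>k\<in>{1..K}. real (l k))"
          using Suc j by (intro member_le_sum) auto
        then show ?thesis using Suc j by (simp add: as_Suc)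
      qed
    qed simp
  qed
  have c: "real (m + l k) < c" if "k \<in> {1..K}" for k
  proof -
    have "k = Suc (k - 1)" "k - 1 < K" using that by auto
    then obtain j where j: "k = Suc j" "j < K" by blast
    then have "Re (as ! Suc j) - 1 < c" using adm by (auto simp: meijerG_admissible_def)
    then show ?thesis using j by (simp add: as_Suc)
  qed
  have cpos: "c > 0" using c[of 1] K by (simp add: add_pos_nonneg)
  define H where "H = (\<lambda>\<tau>. (\<Prod>k\<in>{1..K}. Gamma (of_nat (Suc (m + l k - 1))) *
      Gamma (Complex c \<tau> - of_nat (Suc (m + l k - 1))) / Gamma (Complex c \<tau>)) / Complex c \<tau>)"
  have main: "(LINT \<tau>|lborel. H \<tau> * exp (Complex c \<tau> * of_real (ln x))) = of_real (2 * pi * g_fun K m l x)"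
  proof -
    have "real (Suc (m + l k - 1)) < c" if "k \<in> {1..K}" for k using c[OF that] m by simp
    then show ?thesis
      using mellin_barnes_region_moment[of "{1..K}" "\<lambda>k. m + l k - 1" c] K x
      unfolding H_def g_fun_eq_region_moment by simp
  qed
  have integrand: "H \<tau> * exp (Complex c \<tau> * of_real (ln x))
      = of_real (\<Prod>k\<in>{1..K}. Gamma (real (m + l k))) * meijerG_integrand 0 (K + 1) as bs x (Complex c \<tau>)" for \<tau>
  proof -
    let ?s = "Complex c \<tau>"
    have s: "?s \<notin> \<int>\<^sub>\<le>\<^sub>0" using cpos by (intro not_nonpos_Ints_Re_pos) simp
    have s0: "?s \<noteq> 0" using cpos by (simp add: complex_eq_iff)
    have G: "Gamma ?s \<noteq> 0" using s by (simp only: Gamma_eq_zero_iff not_False_eq_True)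
    have rG: "rGamma (1 + ?s) = 1 / (?s * Gamma ?s)"
      unfolding rGamma_inverse_Gamma add.commute[of 1] Gamma_plus1[OF s] by (simp only: inverse_eq_divide)
    have "(\<Prod>j<K + 1. Gamma (1 - as ! j + ?s)) = Gamma ?s * (\<Prod>j<K. Gamma (?s - of_nat (m + l (Suc j))))"
    proof -
      have "(\<Prod>j<K. Gamma (1 - as ! Suc j + ?s)) = (\<Prod>j<K. Gamma (?s - of_nat (m + l (Suc j))))"
        by (intro prod.cong refl arg_cong[where f=Gamma]) (simp add: as_Suc)
      then show ?thesis
        unfolding Suc_eq_plus1[symmetric] prod.lessThan_Suc_shift by (simp add: as0)
    qed
    also have "(\<Prod>j<K. Gamma (?s - of_nat (m + l (Suc j)))) = (\<Prod>k\<in>{1..K}. Gamma (?s - of_nat (m + l k)))"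
      using prod.atLeast1_atMost_eq[of "\<lambda>k. Gamma (?s - of_nat (m + l k))" K] by simp
    finally have num: "(\<Prod>j<K + 1. Gamma (1 - as ! j + ?s)) = Gamma ?s * (\<Prod>k\<in>{1..K}. Gamma (?s - of_nat (m + l k)))" .
    have "(\<Prod>j\<in>{0..<length bs}. rGamma (1 - bs ! j + ?s)) = (\<Prod>j<K. rGamma (1 - bs ! j + ?s)) * rGamma (1 - bs ! K + ?s)"
      by (simp only: len atLeast0LessThan Suc_eq_plus1[symmetric] prod.lessThan_Suc)
    also have "\<dots> = (1 / Gamma ?s) ^ K * (1 / (?s * Gamma ?s))"
      by (simp add: bs_nth rG[symmetric]) (simp add: rGamma_inverse_Gamma power_inverse divide_inverse)
    finally have den: "(\<Prod>j\<in>{0..<length bs}. rGamma (1 - bs ! j + ?s)) = (1 / Gamma ?s) ^ K * (1 / (?s * Gamma ?s))" .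
    have M: "meijerG_integrand 0 (K + 1) as bs x ?s
        = (\<Prod>k\<in>{1..K}. Gamma (?s - of_nat (m + l k))) * (1 / Gamma ?s) ^ K * (1 / ?s) * exp (?s * of_real (ln x))"
      unfolding meijerG_integrand_def num den using G s0 by (simp add: len)
    have "H \<tau> = (\<Prod>k\<in>{1..K}. of_real (Gamma (real (m + l k))) * Gamma (?s - of_nat (m + l k)) * (1 / Gamma ?s)) * (1 / ?s)"
      unfolding H_def using m
      by (simp add: Gamma_complex_of_real[symmetric] del: of_nat_add)
    also have "\<dots> = of_real (\<Prod>k\<in>{1..K}. Gamma (real (m + l k))) * ((\<Prod>k\<in>{1..K}. Gamma (?s - of_nat (m + l k))) * (1 / Gamma ?s) ^ K * (1 / ?s))"
      by (simp only: prod.distrib prod_constant of_real_prod card_atLeastAtMost diff_Suc_1 mult.assoc)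
    finally show ?thesis unfolding M by (simp only: mult.assoc)
  qed
  have "of_real (2 * pi) * of_real (g_fun K m l x)
      = of_real (\<Prod>k\<in>{1..K}. Gamma (real (m + l k))) * (LINT \<tau>|lborel. meijerG_integrand 0 (K + 1) as bs x (Complex c \<tau>))"
    using main unfolding integrand integral_mult_right_zero by simp
  then have "of_real (g_fun K m l x)
      = of_real (\<Prod>k\<in>{1..K}. Gamma (real (m + l k))) * ((LINT \<tau>|lborel. meijerG_integrand 0 (K + 1) as bs x (Complex c \<tau>)) / (2 * pi))"
    by (simp add: field_simps)
  then show ?thesis
    unfolding meijerG_def meijerG_line_def as_def[symmetric] bs_def[symmetric] c_def[symmetric] .
qed

section \<open>Both claims in the original parameters\<close>

theorem theorem2:
  fixes K m :: nat
    and \<sigma>2 P lam :: "nat \<Rightarrow> real"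
    and N0 \<gamma> :: real
    and \<theta> \<Omega> :: "nat \<Rightarrow> real"
    and l :: "nat \<Rightarrow> nat"
    and M :: "'a measure"
    and R :: "nat \<Rightarrow> 'a \<Rightarrow> real"
    and x :: real
  assumes K: "K \<ge> 1" and m: "m \<ge> 1"
    and \<sigma>2: "\<forall>k\<in>{1..K}. \<sigma>2 k > 0"
    and P: "\<forall>k\<in>{1..K}. P k > 0"
    and lam: "\<forall>k\<in>{1..K}. 0 \<le> lam k \<and> lam k < 1"
    and N0: "N0 > 0"
    and \<gamma>_def: "\<gamma> = (\<Sum>k\<in>{1..K}. P k) / N0"
    and \<theta>_def: "\<forall>k\<in>{1..K}. \<theta> k = P k / (\<Sum>j\<in>{1..K}. P j)"
    and \<Omega>_def: "\<forall>k\<in>{1..K}. \<Omega> k = P k * \<sigma>2 k * (1 - (lam k)\<^sup>2) / (real m * N0)"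
    and M: "prob_space M"
    and indep: "prob_space.indep_vars M (\<lambda>_. borel) R {1..K}"
    and distr: "\<forall>k\<in>{1..K}. distributed M lborel (R k)
                  (\<lambda>y. ennreal (gamma_density (real (m + l k)) (\<Omega> k) y))"
    and x: "x > 0"
  shows "((\<lambda>n. (1 / \<gamma> ^ (m * K + (\<Sum>k\<in>{1..K}. l k)))
              * (\<Prod>k\<in>{1..K}. (1 / Gamma (real (m + l k)))
                   * (real m / (\<theta> k * \<sigma>2 k * (1 - (lam k)\<^sup>2))) ^ (m + l k))
              * ((\<Prod>k\<in>{1..K}. (1 / fact (n k))
                   * (- (real m / (\<gamma> * \<theta> k * \<sigma>2 k * (1 - (lam k)\<^sup>2)))) ^ (n k))
                 * g_fun K m (\<lambda>k. n k + l k) x))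
          has_sum measure M {\<omega> \<in> space M. (\<Prod>k\<in>{1..K}. 1 + R k \<omega>) \<le> x})
         {n :: nat \<Rightarrow> nat. \<forall>k. k \<notin> {1..K} \<longrightarrow> n k = 0}
       \<and> complex_of_real (g_fun K m l x)
           = complex_of_real (\<Prod>k\<in>{1..K}. Gamma (real (m + l k)))
             * meijerG 0 (K + 1)
                 (1 # map (\<lambda>k. of_nat (1 + l k + m)) [1..<K+1])
                 (replicate K 1 @ [0]) x"
proof
  let ?I = "{1..K}"
  interpret prob_space M by (rule M)
  have sumP: "(\<Sum>k\<in>?I. P k) > 0" using K P by (intro sum_pos) auto
  have \<gamma>: "\<gamma> > 0" using sumP N0 by (simp add: \<gamma>_def)
  have lam': "1 - (lam k)\<^sup>2 > 0" if "k \<in> ?I" for k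
    using lam that by (simp add: power_less_one_iff abs_square_less_1)
  define d where "d = (\<lambda>k. \<theta> k * \<sigma>2 k * (1 - (lam k)\<^sup>2))"
  have d: "d k > 0" if "k \<in> ?I" for k
    using that sumP P \<sigma>2 lam'[OF that] by (simp add: d_def \<theta>_def)
  have \<Omega>: "\<Omega> k = \<gamma> * d k / real m" if "k \<in> ?I" for k
    using that sumP N0 m by (simp add: d_def \<Omega>_def \<gamma>_def \<theta>_def)
  have \<Omega>pos: "\<Omega> k > 0" if "k \<in> ?I" for k using \<Omega>[OF that] d[OF that] \<gamma> m by simp
  have const: "(1 / \<gamma> ^ (m * K + (\<Sum>k\<in>?I. l k))) * (\<Prod>k\<in>?I. (1 / Gamma (real (m + l k))) * (real m / d k) ^ (m + l k))
      = (\<Prod>k\<in>?I. 1 / (Gamma (real (m + l k)) * \<Omega> k ^ (m + l k)))"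
  proof -
    \<comment> \<open>The exponent is the sum of the shapes m + l_k, so the power of gamma spreads
      over the factors and turns each m / d_k into 1 / Omega_k.\<close>
    have "\<gamma> ^ (m * K + (\<Sum>k\<in>?I. l k)) = (\<Prod>k\<in>?I. \<gamma> ^ (m + l k))"
      by (simp add: power_sum[symmetric] sum.distrib mult.commute)
    then have "1 / \<gamma> ^ (m * K + (\<Sum>k\<in>?I. l k)) = (\<Prod>k\<in>?I. 1 / \<gamma> ^ (m + l k))"
      by (simp add: prod_dividef)
    then have "(1 / \<gamma> ^ (m * K + (\<Sum>k\<in>?I. l k))) * (\<Prod>k\<in>?I. (1 / Gamma (real (m + l k))) * (real m / d k) ^ (m + l k))
        = (\<Prod>k\<in>?I. (1 / \<gamma> ^ (m + l k)) * ((1 / Gamma (real (m + l k))) * (real m / d k) ^ (m + l k)))"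
      by (simp only: prod.distrib)
    also have "\<dots> = (\<Prod>k\<in>?I. 1 / (Gamma (real (m + l k)) * \<Omega> k ^ (m + l k)))"
      by (intro prod.cong refl) (simp add: \<Omega> power_divide power_mult_distrib)
    finally show ?thesis .
  qed
  have series: "((\<lambda>n. (\<Prod>k\<in>?I. 1 / (Gamma (real (m + l k)) * \<Omega> k ^ (m + l k))) *
      ((\<Prod>k\<in>?I. (- (1 / \<Omega> k)) ^ n k / fact (n k)) * region_moment ?I (\<lambda>k. n k + (m + l k - 1)) x))
    has_sum measure M {\<omega> \<in> space M. (\<Prod>k\<in>?I. 1 + R k \<omega>) \<le> x}) {n. \<forall>k. k \<notin> ?I \<longrightarrow> n k = 0}"
    using K m \<Omega>pos distr by (intro gamma_product_cdf_has_sum indep) auto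
  have factor: "(\<Prod>k\<in>?I. (- (1 / \<Omega> k)) ^ n k / fact (n k)) = (\<Prod>k\<in>?I. (1 / fact (n k)) * (- (real m / (\<gamma> * \<theta> k * \<sigma>2 k * (1 - (lam k)\<^sup>2)))) ^ n k)" for n :: "nat \<Rightarrow> nat"
    by (intro prod.cong refl) (simp add: \<Omega> d_def mult.assoc)
  \<comment> \<open>The truncated subtraction of 1 commutes with adding n_k because m >= 1.\<close>
  have moment: "region_moment ?I (\<lambda>k. n k + (m + l k - 1)) x = g_fun K m (\<lambda>k. n k + l k) x" for n :: "nat \<Rightarrow> nat"
    using m by (simp add: g_fun_eq_region_moment add.left_commute)
  show "((\<lambda>n. (1 / \<gamma> ^ (m * K + (\<Sum>k\<in>{1..K}. l k)))
              * (\<Prod>k\<in>{1..K}. (1 / Gamma (real (m + l k)))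
                   * (real m / (\<theta> k * \<sigma>2 k * (1 - (lam k)\<^sup>2))) ^ (m + l k))
              * ((\<Prod>k\<in>{1..K}. (1 / fact (n k))
                   * (- (real m / (\<gamma> * \<theta> k * \<sigma>2 k * (1 - (lam k)\<^sup>2)))) ^ (n k))
                 * g_fun K m (\<lambda>k. n k + l k) x))
          has_sum measure M {\<omega> \<in> space M. (\<Prod>k\<in>{1..K}. 1 + R k \<omega>) \<le> x})
         {n :: nat \<Rightarrow> nat. \<forall>k. k \<notin> {1..K} \<longrightarrow> n k = 0}"
    using series by (simp only: factor moment const[unfolded d_def])
  show "complex_of_real (g_fun K m l x)
           = complex_of_real (\<Prod>k\<in>{1..K}. Gamma (real (m + l k)))
             * meijerG 0 (K + 1)
                 (1 # map (\<lambda>k. of_nat (1 + l k + m)) [1..<K+1])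
                 (replicate K 1 @ [0]) x"
    by (rule g_fun_eq_meijerG[OF K m x])
qed

end
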